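(* The map $\Phi$ (defined in the context) is a size-preserving bijection from increasing ordered trees to perfect matchings (represented as PM dot diagrams), i.e. for each $n\ge 1$ it restricts to a bijection from the $n$-edge increasing ordered trees to the perfect matchings of $[2n]$, and it sends (Klazar violator, partner) pairs $(i,j)$ to uplines $i\nearrow j$: if $i$ is a Klazar violator with partner $j$ in an increasing ordered tree $T$, then in $\Phi(T)$ the $i$th dot of the bottom row is matched to the $j$th dot of the top row and this is an upline.
   Context: Trees. An increasing ordered tree of size $n$ is a rooted ordered (plane) tree with $n$ edges whose vertices are labeled bijectively by $0,1,\dots,n$ so that each child's label exceeds its parent's; vertices are identified with labels. If $u,v$ are adjacent siblings with $u$ immediately to the left of $v$, then $u$ is the left neighbor of $v$ and $v$ is the right neighbor of $u$; if also $u>v$, then $v$ is a descent terminator. The cohort of $v$ is the left-to-right list of siblings strictly to its left; the big cohort of $v$ is the maximal terminal (rightmost) sublist of its cohort all of whose entries exceed $v$; the associate of a descent terminator $v$ is the smallest entry of its big cohort. A Klazar violator (KV) is a descent terminator $v$ whose associate is smaller than every child of $v$ (vacuously true for a leaf). A vertex that is not a KV is Klazar compliant (KC). The partner $p(v)$ of a KV $v$ is its rightmost child or its closest left sibling, whichever is larger if both are present. A child vertex is a non-root vertex; a child vertex is a non-partner if it is not the partner of any KV. (Each vertex is the partner of at most one KV.) Map $H$. For a KC child vertex $v$ put $v_1=v$; as long as $v_i$ is the partner of a (unique) KV, let $v_{i+1}$ be that KV; then $v_1>v_2>\cdots$, and $H(v)$ is the first $v_k$ that is a non-partner. Map $F$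 on trees $T$ of size $n$. If $n$ has no right neighbor, $F(T)=T$. Suppose $n$ has right neighbor $j$. If $j$ is a KV with associate $a\ne n$, transfer $a$ together with the big cohort of $a$ (with their subtrees, preserving order) so that they become the leftmost segment of the children of $j$. If $j$ is KC, transfer the smallest child of $j$ together with that child's cohort (with their subtrees, preserving order) so that they become siblings of $j$ immediately to the left of the big cohort of $j$. (If $j$ is a KV with associate $n$, put $F(T)=T$; this case is not used below.) $P(T)$ denotes the tree of size $n-1$ obtained from $T$ by deleting the leaf $n$ and its edge. Dot diagrams. A perfect matching of $[2n]$ is drawn as a PM dot diagram of size $n$: two rows of $n$ dots, the $i$th top dot ("$i$ top") representing $2i-1$ and the $i$th bottom dot ("$i$ bot") representing $2i$, with matched dots joined. An upline $i\nearrow j$ is a match of $i$ bot with $j$ top where $i<j$ (an even number matched to a larger odd number). A diagram of size $n-1$ is enlarged to size $n$ by adding a dot at the end of each row and then: "using $n$ bot" means joining the two new dots to each other, leaving everything else intact; "using" one of the $2n-2$ old dots $d$ means joining the new top dot to $d$, and replacing the edge from $d$ to its old partner $d'$ by an edge from $d'$ to the new bottom dot. Definition of $\Phi$. $\Phi$ sends the unique tree of size 1 to the unique diagram of size 1. For $T$ of size $n\ge2$: (1) if $n$ is the rightmost child of the root, $\Phi(T)$ is $\Phi(P(T))$ enlarged using $n$ bot; (2) if $n$ is the rightmost child of a KV $j$ (then $j$ is a KV in $P(T)$), $\Phi(T)$ is $\Phi(P(T))$ enlarged using $j$ bot; (3) if $n$ is the left neighbor of a KV $j$ and $n$ is the associate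 of $j$ (then $j$ is a KC leaf in $P(T)$), $\Phi(T)$ is $\Phi(P(T))$ enlarged using $j$ bot; (4) if $n$ is the rightmost child of a non-root KC vertex $j$ (then $j$ is KC in $P(T)$), $\Phi(T)$ is $\Phi(P(T))$ enlarged using $H(j)$ top, with $H$ computed in $P(T)$; (5) if $n$ is the left neighbor of a KV $j$ and $n$ is not the associate of $j$ (then $j$ is a KC non-leaf in $P(F(T))$), $\Phi(T)$ is $\Phi(P(F(T)))$ enlarged using $j$ bot; (6) if $n$ is the left neighbor of a KC vertex $j$ (then $j$ is a KV in $P(F(T))$), $\Phi(T)$ is $\Phi(P(F(T)))$ enlarged using $p(j)$ top, with $p(j)$ the partner of $j$ in $P(F(T))$. *)

theory Defs
  imports Main "HOL-Library.Disjoint_Sets" "HOL-Library.While_Combinator"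
begin

text \<open>
  A vertex-labelled ordered tree is given by its child lists: \<open>T u\<close> is the left-to-right list of
  the children of \<open>u\<close>. Labels \<open>0, \<dots>, n\<close> are the vertices. Since children exceed
  their parents, the root is \<open>0\<close>, and unique parenthood of \<open>1, \<dots>, n\<close> already makes
  \<open>T\<close> a tree with \<open>n\<close> edges (see \<open>inc_trees_reachable\<close>). Moreover \<open>T u = []\<close> for
  \<open>u > n\<close>, so that equality of functions is equality of trees.
\<close>

type_synonym otree = "nat \<Rightarrow> nat list"

definition inc_trees :: "nat \<Rightarrow> otree set" where
  "inc_trees n = {T. (\<forall>u. distinct (T u)) \<and>
                     (\<forall>u. set (T u) \<subseteq> {u<..n}) \<and>
                     (\<forall>v\<in>{1..n}. \<exists>!u. v \<in> set (T u))}"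

lemma inc_trees_reachable:
  assumes "T \<in> inc_trees n" "v \<le> n"
  shows "(0, v) \<in> {(u, w). w \<in> set (T u)}\<^sup>*"
  using assms(2)
proof (induction v rule: less_induct)
  case (less v)
  show ?case
  proof (cases "v = 0")
    case False
    then obtain u where u: "v \<in> set (T u)"
      using assms(1) less.prems unfolding inc_trees_def by fastforce
    then have "u < v"
      using assms(1) unfolding inc_trees_def by fastforce
    then have "(0, u) \<in> {(u, w). w \<in> set (T u)}\<^sup>*"
      using less by simp
    with u show ?thesis
      by (meson CollectI case_prodI rtrancl.rtrancl_into_rtrancl)
  qed simp
qed

text \<open>\<open>parent\<close>, \<open>cohort\<close>, \<open>big_cohort\<close> and \<open>associate\<close> are
  meaningful for child vertices only.\<close>

definition parent :: "otree \<Rightarrow> nat \<Rightarrow> nat" where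
  "parent T v = (THE u. v \<in> set (T u))"

text \<open>\<open>left_neighbor T u v\<close>: \<open>u\<close> is the left neighbor of \<open>v\<close>.\<close>

definition left_neighbor :: "otree \<Rightarrow> nat \<Rightarrow> nat \<Rightarrow> bool" where
  "left_neighbor T u v \<longleftrightarrow> (\<exists>w xs ys. T w = xs @ u # v # ys)"

definition descent_terminator :: "otree \<Rightarrow> nat \<Rightarrow> bool" where
  "descent_terminator T v \<longleftrightarrow> (\<exists>u. left_neighbor T u v \<and> u > v)"

definition cohort :: "otree \<Rightarrow> nat \<Rightarrow> nat list" where
  "cohort T v = takeWhile (\<lambda>u. u \<noteq> v) (T (parent T v))"

definition big_cohort :: "otree \<Rightarrow> nat \<Rightarrow> nat list" where
  "big_cohort T v = rev (takeWhile (\<lambda>u. u > v) (rev (cohort T v)))"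

definition associate :: "otree \<Rightarrow> nat \<Rightarrow> nat" where
  "associate T v = Min (set (big_cohort T v))"

text \<open>Klazar violators; a vertex is Klazar compliant iff it is not a Klazar violator.\<close>

definition KV :: "otree \<Rightarrow> nat \<Rightarrow> bool" where
  "KV T v \<longleftrightarrow> descent_terminator T v \<and> (\<forall>c\<in>set (T v). associate T v < c)"

text \<open>A Klazar violator always has a left sibling, whereas it may be a leaf.\<close>

definition partner :: "otree \<Rightarrow> nat \<Rightarrow> nat" where
  "partner T v = (if T v = [] then last (cohort T v)
                  else max (last (T v)) (last (cohort T v)))"

text \<open>
  The starting vertex is a Klazar compliant child vertex. A vertex is the partner of at most one
  Klazar violator, and this violator is smaller, so the loop is well defined and terminates at the
  first vertex that is not a partner.
\<close>

definition map_H :: "otree \<Rightarrow> nat \<Rightarrow> nat" where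
  "map_H T v = while (\<lambda>u. \<exists>i. KV T i \<and> partner T i = u)
                 (\<lambda>u. THE i. KV T i \<and> partner T i = u) v"

text \<open>
  The parameter \<open>n\<close> of the maps below is the size of the tree.
  In both transfers of \<open>map_F\<close>, the transferred segment ends with the vertex named in the rule
  (the associate of \<open>j\<close>, or the smallest child of \<open>j\<close>). In the second one, the children
  of the parent of \<open>j\<close> are a prefix, the big cohort of \<open>j\<close>, and the part starting with
  \<open>j\<close>, in this order.
\<close>

definition map_F :: "nat \<Rightarrow> otree \<Rightarrow> otree" where
  "map_F n T =
    (if \<exists>j. left_neighbor T n j then
       let j = (THE j. left_neighbor T n j); w = parent T j in
       if KV T j then
         let a = associate T j; seg = big_cohort T a @ [a] in
         if a = n then T
         else T(w := filter (\<lambda>x. x \<notin> set seg) (T w), j := seg @ T j)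
       else
         let c = Min (set (T j)); seg = cohort T c @ [c];
             pre = take (length (cohort T j) - length (big_cohort T j)) (T w)
         in T(w := pre @ seg @ drop (length pre) (T w),
              j := drop (length seg) (T j))
     else T)"

definition delete_max :: "nat \<Rightarrow> otree \<Rightarrow> otree" where
  "delete_max n T = (\<lambda>v. filter (\<lambda>x. x \<noteq> n) (T v))"

text \<open>Matched dots form the two-element blocks of a matching.\<close>

type_synonym diagram = "nat set set"

definition perfect_matchings :: "nat \<Rightarrow> diagram set" where
  "perfect_matchings n = {M. partition_on {1..2 * n} M \<and> (\<forall>e\<in>M. card e = 2)}"

definition top_dot :: "nat \<Rightarrow> nat" where
  "top_dot i = 2 * i - 1"

definition bot_dot :: "nat \<Rightarrow> nat" where
  "bot_dot i = 2 * i"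

definition upline :: "diagram \<Rightarrow> nat \<Rightarrow> nat \<Rightarrow> bool" where
  "upline M i j \<longleftrightarrow> {bot_dot i, top_dot j} \<in> M \<and> i < j"

definition mate :: "diagram \<Rightarrow> nat \<Rightarrow> nat" where
  "mate M d = (THE d'. {d, d'} \<in> M)"

text \<open>Enlarging a diagram of size \<open>n - 1\<close> to size \<open>n\<close>, using \<open>n\<close> bot and
  using an old dot \<open>d\<close>, respectively.\<close>

definition enlarge_new :: "nat \<Rightarrow> diagram \<Rightarrow> diagram" where
  "enlarge_new n M = insert {top_dot n, bot_dot n} M"

definition enlarge_old :: "nat \<Rightarrow> nat \<Rightarrow> diagram \<Rightarrow> diagram" where
  "enlarge_old n d M =
     (M - {{d, mate M d}}) \<union> {{top_dot n, d}, {mate M d, bot_dot n}}"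

text \<open>
  In a tree of size \<open>n\<close>, the vertex \<open>n\<close> either has a right neighbor or is the rightmost
  child of its parent. The value at size \<open>0\<close> is a dummy.
\<close>

fun Phi :: "nat \<Rightarrow> otree \<Rightarrow> diagram" where
  "Phi 0 T = {}"
| "Phi (Suc 0) T = {{top_dot 1, bot_dot 1}}"
| "Phi (Suc (Suc m)) T =
    (let n = Suc (Suc m) in
     if \<exists>j. left_neighbor T n j then
       let j = (THE j. left_neighbor T n j); PF = delete_max n (map_F n T) in
       if KV T j \<and> associate T j = n then
         enlarge_old n (bot_dot j) (Phi (Suc m) (delete_max n T))
       else if KV T j then
         enlarge_old n (bot_dot j) (Phi (Suc m) PF)
       else
         enlarge_old n (top_dot (partner PF j)) (Phi (Suc m) PF)
     else
       let j = parent T n in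
       if j = 0 then
         enlarge_new n (Phi (Suc m) (delete_max n T))
       else if KV T j then
         enlarge_old n (bot_dot j) (Phi (Suc m) (delete_max n T))
       else
         enlarge_old n (top_dot (map_H (delete_max n T) j)) (Phi (Suc m) (delete_max n T)))"

end

theory Submission
  imports Defs
begin

text \<open>
  The largest vertex \<open>n = m + 1\<close> of an increasing ordered tree is a leaf. Deleting it leaves a
  tree \<open>T\<close> of size \<open>m\<close>, and the position of \<open>n\<close> is one of
  \<open>2m + 1\<close> \<^emph>\<open>grafting sites\<close> of \<open>T\<close>: the rightmost child of
  one of the vertices \<open>0, \<dots>, m\<close>, or the left neighbor of one of \<open>1, \<dots>, m\<close>
  (lemma \<open>graft_bij\<close>). On the other side, a perfect matching of \<open>[2n]\<close> is a perfect
  matching of \<open>[2m]\<close> together with one of \<open>2m + 1\<close> dots that is used to enlarge it, because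
  the used dot can be read off as the mate of the new top dot (lemma \<open>enlarge_bij\<close>).
  In one step, \<open>\<Phi>\<close> turns a pair (tree of size \<open>m\<close>, site) into a pair (tree of size
  \<open>m\<close>, dot); the function \<open>tree_and_dot\<close> describes this step and \<open>Phi_graft\<close>
  says that \<open>\<Phi>\<close> is its iteration. Hence \<open>\<Phi>\<close> is bijective as soon as
  \<open>tree_and_dot\<close> is, and as both sides have the same finite number of elements, it suffices
  that \<open>tree_and_dot\<close> is onto.

  The tree component changes only through \<open>F\<close>, which acts on \<open>T\<close> alone, as an
  involution \<open>toggle j\<close>. Around a KV \<open>j\<close> the siblings read \<open>X B\<^sub>1 a B\<^sub>2 j Z\<close>
  and the children of \<open>j\<close> are \<open>C\<close>, where \<open>X\<close> is empty or ends below \<open>j\<close>,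
  where \<open>j < a\<close>, and where \<open>a\<close> is smaller than all entries of \<open>B\<^sub>1\<close>,
  \<open>B\<^sub>2\<close> and \<open>C\<close>. Moving \<open>B\<^sub>1 a\<close> to the front of the children gives
  siblings \<open>X B\<^sub>2 j Z\<close> and children \<open>B\<^sub>1 a C\<close>; now \<open>j\<close> is a
  Klazar compliant child vertex with at least one child, and every such vertex arises exactly once in this way,
  because \<open>a\<close> is recovered as its smallest child. The move concerns only entries larger than
  \<open>j\<close> that precede \<open>j\<close>, so for vertices other than \<open>j\<close> it changes neither
  the property of being a KV nor the partner (\<open>tree_transfer.other_KV\<close>). So the dot
  \<open>j\<close> bot is reached from exactly one tree and site: the site is below \<open>j\<close> if
  \<open>j\<close> is a KV of the resulting tree, and to the left of \<open>j\<close> otherwise. The dot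
  \<open>k\<close> top is reached from the site to the left of \<open>i\<close> if \<open>k\<close> is the
  partner of a KV \<open>i\<close> of the resulting tree; if \<open>k\<close> is a non-partner,
  it is reached from the site below the vertex \<open>v\<close> with \<open>H(v) = k\<close>,
  which is the Klazar compliant end of the chain of partners that starts at \<open>k\<close> (\<open>map_H_surj\<close>).

  For the uplines, enlarging with a dot \<open>d\<close> destroys only the edge at \<open>d\<close>. If \<open>d\<close>
  is \<open>i\<close> bot, then \<open>n\<close> becomes the partner of the KV \<open>i\<close>, and
  \<open>i\<close> bot is joined to \<open>n\<close> top. Every other KV of the new tree is a KV of the smaller
  tree with the same partner, and its edge does not contain \<open>d\<close> (\<open>graft_KV_pairs\<close>):
  a used dot \<open>k\<close> top belongs either to a non-partner or to the partner of a vertex that ceases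
  to be a KV.
\<close>

section \<open>Klazar violators in terms of sibling lists\<close>

lemma inc_trees_distinct: "T \<in> inc_trees n \<Longrightarrow> distinct (T u)"
  by (simp add: inc_trees_def)

lemma inc_trees_child:
  assumes "T \<in> inc_trees n" "v \<in> set (T u)"
  shows "u < v" "v \<le> n"
proof -
  have "v \<in> {u<..n}" using assms by (auto simp: inc_trees_def simp del: greaterThanAtMost_iff)
  then show "u < v" "v \<le> n" by auto
qed

lemma inc_trees_parent_unique:
  assumes "T \<in> inc_trees n" "v \<in> set (T u)" "v \<in> set (T u')"
  shows "u = u'"
proof -
  have "v \<in> {1..n}" using inc_trees_child[OF assms(1,2)] by auto
  then have "\<exists>!u. v \<in> set (T u)" using assms(1) by (simp add: inc_trees_def)
  then show ?thesis using assms by blast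
qed

lemma inc_treesI:
  assumes "\<And>u. distinct (T u)" "\<And>u v. v \<in> set (T u) \<Longrightarrow> u < v \<and> v \<le> n"
    "\<And>v. 1 \<le> v \<Longrightarrow> v \<le> n \<Longrightarrow> \<exists>u. v \<in> set (T u)"
    "\<And>u u' v. v \<in> set (T u) \<Longrightarrow> v \<in> set (T u') \<Longrightarrow> u = u'"
  shows "T \<in> inc_trees n"
  unfolding inc_trees_def using assms by auto

lemma inc_trees_parent_exists:
  assumes "T \<in> inc_trees n" "1 \<le> v" "v \<le> n"
  obtains w where "v \<in> set (T w)"
proof -
  have "\<exists>!u. v \<in> set (T u)" using assms by (simp add: inc_trees_def)
  then show ?thesis using that by blast
qed

lemma inc_trees_child_split:
  assumes "T \<in> inc_trees n" "1 \<le> v" "v \<le> n"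
  obtains w ps qs where "T w = ps @ v # qs"
  using inc_trees_parent_exists[OF assms] split_list that by metis

lemma sibling_split_unique:
  assumes "T \<in> inc_trees n" "T w = ps @ v # qs" "T w' = ps' @ v # qs'"
  shows "w = w'" "ps = ps'" "qs = qs'"
proof -
  show w: "w = w'"
    using inc_trees_parent_unique[OF assms(1), of v w w'] assms(2,3) by auto
  have "distinct (ps @ v # qs)" using assms inc_trees_distinct by metis
  then show "ps = ps'" "qs = qs'"
    using assms(2,3) w append_Cons_eq_iff[of v ps qs ps' qs'] by auto
qed

lemma parent_eq:
  assumes "T \<in> inc_trees n" "v \<in> set (T w)"
  shows "parent T v = w"
  unfolding parent_def using assms inc_trees_parent_unique by blast

lemma cohort_eq:
  assumes "T \<in> inc_trees n" "T w = ps @ v # qs"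
  shows "cohort T v = ps"
proof -
  have "v \<notin> set ps" using inc_trees_distinct[OF assms(1), of w] assms(2) by auto
  then show ?thesis
    using assms parent_eq[of T n v w] by (auto simp: cohort_def takeWhile_append)
qed

text \<open>
  Applied to the cohort of \<open>v\<close>, this is the big cohort of \<open>v\<close>. As a function of a
  list it can be computed for a list that is given as a concatenation, whatever tree it comes from.
\<close>

definition larger_suffix :: "nat \<Rightarrow> nat list \<Rightarrow> nat list" where
  "larger_suffix v xs = rev (takeWhile (\<lambda>u. u > v) (rev xs))"

lemma larger_suffix_Nil [simp]: "larger_suffix v [] = []"
  by (simp add: larger_suffix_def)

lemma larger_suffix_append:
  "larger_suffix v (xs @ ys) =
     (if \<forall>y\<in>set ys. v < y then larger_suffix v xs @ ys else larger_suffix v ys)"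
  by (auto simp: larger_suffix_def takeWhile_append)

lemma larger_suffix_all: "\<forall>y\<in>set ys. v < y \<Longrightarrow> larger_suffix v ys = ys"
  using larger_suffix_append[of v "[]" ys] by simp

lemma larger_suffix_Nil_iff: "larger_suffix v xs = [] \<longleftrightarrow> xs = [] \<or> last xs \<le> v"
  by (cases xs rule: rev_cases) (auto simp: larger_suffix_def)

lemma larger_suffix_split:
  obtains X where "xs = X @ larger_suffix v xs" "X = [] \<or> last X \<le> v"
    "\<forall>y\<in>set (larger_suffix v xs). v < y"
proof -
  let ?p = "\<lambda>u. u > v"
  let ?X = "rev (dropWhile ?p (rev xs))"
  have "xs = ?X @ larger_suffix v xs"
    unfolding larger_suffix_def by (metis rev_append rev_rev_ident takeWhile_dropWhile_id)
  moreover have "?X = [] \<or> last ?X \<le> v"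
    using hd_dropWhile[of ?p "rev xs"] by (cases "dropWhile ?p (rev xs) = []") (auto simp: last_rev)
  moreover have "\<forall>y\<in>set (larger_suffix v xs). v < y"
    unfolding larger_suffix_def by (auto dest: set_takeWhileD)
  ultimately show ?thesis using that by blast
qed

text \<open>
  An entry that is not larger than \<open>v\<close> stops the search for the big cohort; what stands to the
  left of it can be changed freely.
\<close>

lemma larger_suffix_blocked:
  assumes "X = [] \<or> last X \<le> v"
  shows "larger_suffix v (X @ ys) = larger_suffix v ys"
proof -
  have "larger_suffix v X = []" using assms larger_suffix_Nil_iff by blast
  then show ?thesis by (simp add: larger_suffix_append larger_suffix_all)
qed

lemma last_larger_suffix: "larger_suffix v xs \<noteq> [] \<Longrightarrow> last (larger_suffix v xs) = last xs"
  by (metis larger_suffix_split last_appendR)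

lemma big_cohort_eq:
  assumes "T \<in> inc_trees n" "T w = ps @ v # qs"
  shows "big_cohort T v = larger_suffix v ps"
  using cohort_eq[OF assms] by (simp add: big_cohort_def larger_suffix_def)

lemma left_neighbor_iff:
  assumes "T \<in> inc_trees n" "T w = ps @ v # qs"
  shows "left_neighbor T u v \<longleftrightarrow> ps \<noteq> [] \<and> u = last ps"
proof
  assume "left_neighbor T u v"
  then obtain w' xs ys where "T w' = (xs @ [u]) @ v # ys" by (auto simp: left_neighbor_def)
  then show "ps \<noteq> [] \<and> u = last ps"
    using sibling_split_unique(2)[OF assms] by fastforce
next
  assume "ps \<noteq> [] \<and> u = last ps"
  then have "T w = butlast ps @ u # v # qs" using assms(2) by simp
  then show "left_neighbor T u v" by (auto simp: left_neighbor_def)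
qed

lemma KV_iff:
  assumes "T \<in> inc_trees n" "T w = ps @ v # qs"
  shows "KV T v \<longleftrightarrow> larger_suffix v ps \<noteq> [] \<and>
           (\<forall>c\<in>set (T v). Min (set (larger_suffix v ps)) < c)"
  unfolding KV_def associate_def descent_terminator_def big_cohort_eq[OF assms]
    left_neighbor_iff[OF assms] larger_suffix_Nil_iff by auto

lemma KV_child:
  assumes "T \<in> inc_trees n" "KV T v"
  obtains w ps qs where "T w = ps @ v # qs"
proof -
  obtain w xs u ys where "T w = xs @ u # v # ys"
    using assms(2) unfolding KV_def descent_terminator_def left_neighbor_def by blast
  then have "T w = (xs @ [u]) @ v # ys" by simp
  then show thesis by (rule that)
qed

lemma KV_has_parent:
  assumes "T \<in> inc_trees n" "KV T v"
  obtains w where "v \<in> set (T w)"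
proof -
  obtain w ps qs where "T w = ps @ v # qs" using KV_child[OF assms] .
  then show ?thesis using that[of w] by simp
qed

lemma KV_range:
  assumes "T \<in> inc_trees n" "KV T v"
  shows "1 \<le> v" "v \<le> n"
proof -
  obtain w where "v \<in> set (T w)" using KV_has_parent[OF assms] .
  then show "1 \<le> v" "v \<le> n" using inc_trees_child[OF assms(1)] by fastforce+
qed

lemma partner_eq:
  assumes "T \<in> inc_trees n" "T w = ps @ v # qs"
  shows "partner T v = (if T v = [] then last ps else max (last (T v)) (last ps))"
  using cohort_eq[OF assms] by (simp add: partner_def)

lemma partner_cases:
  assumes "T \<in> inc_trees n" "KV T v"
  shows "v < partner T v" "partner T v \<le> n"
    "T v \<noteq> [] \<and> partner T v = last (T v) \<or> left_neighbor T (partner T v) v"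
proof -
  obtain w ps qs where s: "T w = ps @ v # qs" using KV_child[OF assms] .
  have ne: "ps \<noteq> []" "v < last ps"
    using assms(2) KV_iff[OF assms(1) s] larger_suffix_Nil_iff[of v ps] by auto
  have "last ps \<in> set (T w)" using ne s by simp
  then have l: "last ps \<le> n" using inc_trees_child[OF assms(1)] by blast
  have c: "last (T v) \<le> n" if "T v \<noteq> []"
    using inc_trees_child[OF assms(1), of "last (T v)" v] that by simp
  show "v < partner T v" "partner T v \<le> n"
    using ne l c by (auto simp: partner_eq[OF assms(1) s])
  show "T v \<noteq> [] \<and> partner T v = last (T v) \<or> left_neighbor T (partner T v) v"
    using ne by (auto simp: partner_eq[OF assms(1) s] left_neighbor_iff[OF assms(1) s] max_def)
qed

text \<open>
  A vertex \<open>p\<close> is the partner of its parent only if it is the rightmost sibling, and otherwise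
  only of its right neighbor, which then exists. The two possibilities exclude each other.
\<close>

lemma partner_inj:
  assumes "T \<in> inc_trees n" "KV T i" "KV T k" "partner T i = partner T k"
  shows "i = k"
proof -
  let ?p = "partner T i"
  \<comment> \<open>A rightmost child is not a left neighbor.\<close>
  have last: "\<And>x. \<not> left_neighbor T ?p x" if "T i \<noteq> []" "?p = last (T i)" for i
  proof
    fix x assume "left_neighbor T ?p x"
    then obtain w xs ys where s: "T w = xs @ ?p # x # ys" by (auto simp: left_neighbor_def)
    have "T i = butlast (T i) @ ?p # []" using that by simp
    from sibling_split_unique(3)[OF assms(1) s this] show False by simp
  qed
  have right: "x = y" if "left_neighbor T ?p x" "left_neighbor T ?p y" for x y
    using that sibling_split_unique(3)[OF assms(1)] unfolding left_neighbor_def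
    by (metis list.inject)
  have up: "x = y" if "T x \<noteq> []" "?p = last (T x)" "T y \<noteq> []" "?p = last (T y)" for x y
    using that inc_trees_parent_unique[OF assms(1), of ?p x y] by (metis last_in_set)
  show ?thesis
    using partner_cases(3)[OF assms(1,2)] partner_cases(3)[OF assms(1,3)] assms(4) last right up
    by metis
qed

text \<open>
  Whether \<open>v\<close> is a KV, and which vertex is its partner, depends only on the minimum and the last
  entry of its big cohort and of its list of children. This relation between lists is therefore what
  a modification of the tree has to respect at \<open>v\<close>.
\<close>

definition same_Min_last :: "nat list \<Rightarrow> nat list \<Rightarrow> bool" where
  "same_Min_last xs ys \<longleftrightarrow> (xs = [] \<longleftrightarrow> ys = []) \<and>
     (xs \<noteq> [] \<longrightarrow> Min (set xs) = Min (set ys) \<and> last xs = last ys)"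

lemma same_Min_last_refl [simp]: "same_Min_last xs xs"
  by (simp add: same_Min_last_def)

text \<open>
  The entry \<open>j\<close> survives, is smaller than the deleted entries and stands to the right of them.
\<close>

lemma same_Min_last_delete:
  assumes "\<forall>s\<in>set S. j < s"
  shows "same_Min_last (X @ S @ B @ j # Z) (X @ B @ j # Z)"
proof -
  have "Min (set (X @ S @ B @ j # Z)) = Min (set (X @ B @ j # Z))"
  proof (rule Min_eqI)
    fix y assume y: "y \<in> set (X @ S @ B @ j # Z)"
    show "Min (set (X @ B @ j # Z)) \<le> y"
    proof (cases "y \<in> set S")
      case True
      then have "j \<le> y" using assms by auto
      moreover have "Min (set (X @ B @ j # Z)) \<le> j" by simp
      ultimately show ?thesis by linarith
    next
      case False
      then have "y \<in> set (X @ B @ j # Z)" using y by auto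
      then show ?thesis by (rule Min_le[OF finite_set])
    qed
  next
    have "Min (set (X @ B @ j # Z)) \<in> set (X @ B @ j # Z)"
      by (rule Min_in) auto
    then show "Min (set (X @ B @ j # Z)) \<in> set (X @ S @ B @ j # Z)" by auto
  qed simp
  then show ?thesis by (simp add: same_Min_last_def)
qed

text \<open>
  A big cohort that reaches into the deleted part also contains \<open>j\<close>.
\<close>

lemma same_Min_last_larger_suffix:
  assumes "\<forall>s\<in>set S. j < s" "\<forall>b\<in>set B. j < b"
  shows "same_Min_last (larger_suffix i (X @ S @ B @ j # Z)) (larger_suffix i (X @ B @ j # Z))"
proof (cases "\<forall>z\<in>set (j # Z). i < z")
  case True
  then have "\<forall>z\<in>set (S @ B @ j # Z). i < z" using assms by fastforce
  then show ?thesis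
    using same_Min_last_delete[OF assms(1), of "larger_suffix i X" B Z]
    by (simp add: larger_suffix_append[of i X])
next
  case False
  have "larger_suffix i (W @ j # Z) = larger_suffix i (j # Z)" for W
    using False larger_suffix_append[of i W "j # Z"] by auto
  from this[of "X @ S @ B"] this[of "X @ B"] show ?thesis by simp
qed

lemma KV_partner_cong:
  assumes "T \<in> inc_trees n" "T' \<in> inc_trees n'"
    "T w = ps @ i # qs" "T' w' = ps' @ i # qs'"
    "same_Min_last (larger_suffix i ps) (larger_suffix i ps')" "same_Min_last (T i) (T' i)"
  shows "KV T i \<longleftrightarrow> KV T' i" "KV T i \<Longrightarrow> partner T i = partner T' i"
proof -
  have c: "(\<forall>c\<in>set xs. m < c) \<longleftrightarrow> xs = [] \<or> m < Min (set xs)" for m :: nat and xs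
    by (cases "xs = []") auto
  show e: "KV T i \<longleftrightarrow> KV T' i"
    unfolding KV_iff[OF assms(1,3)] KV_iff[OF assms(2,4)] c using assms(5,6)
    by (auto simp: same_Min_last_def)
  show "partner T i = partner T' i" if k: "KV T i"
  proof -
    have "larger_suffix i ps \<noteq> []" "larger_suffix i ps' \<noteq> []"
      using k e KV_iff[OF assms(1,3)] KV_iff[OF assms(2,4)] by auto
    then have "last ps = last ps'"
      using assms(5) by (metis same_Min_last_def last_larger_suffix)
    then show ?thesis
      unfolding partner_eq[OF assms(1,3)] partner_eq[OF assms(2,4)] using assms(6)
      by (auto simp: same_Min_last_def)
  qed
qed

section \<open>Inserting and deleting the largest vertex\<close>

lemma delete_max_fun: "delete_max n T u = filter (\<lambda>x. x \<noteq> n) (T u)"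
  by (simp add: delete_max_def)

lemma insert_max_inc_trees:
  assumes "T \<in> inc_trees m" "T u = ps @ qs" "u \<le> m"
  shows "T(u := ps @ Suc m # qs) \<in> inc_trees (Suc m)"
proof (rule inc_treesI)
  have b: "x < Suc m" if "x \<in> set (T v)" for x v
    using inc_trees_child[OF assms(1) that] by simp
  have new: "Suc m \<notin> set (T v)" for v using b by blast
  have s: "v \<in> set ((T(u := ps @ Suc m # qs)) x) \<longleftrightarrow> v \<in> set (T x) \<or> (v = Suc m \<and> x = u)" for v x
    using assms(2) by auto
  show "distinct ((T(u := ps @ Suc m # qs)) v)" for v
    using inc_trees_distinct[OF assms(1), of u] inc_trees_distinct[OF assms(1), of v] new[of u] assms(2)
    by auto
  show "v < x \<and> x \<le> Suc m" if "x \<in> set ((T(u := ps @ Suc m # qs)) v)" for v x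
    using that assms(3) inc_trees_child[OF assms(1), of x v] unfolding s by auto
  show "\<exists>x. v \<in> set ((T(u := ps @ Suc m # qs)) x)" if "1 \<le> v" "v \<le> Suc m" for v
  proof (cases "v = Suc m")
    case False
    then have "v \<le> m" using \<open>v \<le> Suc m\<close> by simp
    then obtain w where "v \<in> set (T w)"
      using inc_trees_parent_exists[OF assms(1) \<open>1 \<le> v\<close>] by blast
    then show ?thesis unfolding s by blast
  qed auto
  show "x = y" if "v \<in> set ((T(u := ps @ Suc m # qs)) x)" "v \<in> set ((T(u := ps @ Suc m # qs)) y)"
    for x y v
    using that new inc_trees_parent_unique[OF assms(1), of v x y] unfolding s by blast
qed

lemma delete_insert_max:
  assumes "T \<in> inc_trees m" "T u = ps @ qs"
  shows "delete_max (Suc m) (T(u := ps @ Suc m # qs)) = T"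
proof
  fix v
  have "Suc m \<notin> set (T x)" for x using inc_trees_child(2)[OF assms(1), of "Suc m" x] by auto
  then have f: "filter (\<lambda>x. x \<noteq> Suc m) (T x) = T x" for x by (metis (mono_tags, lifting) filter_True)
  show "delete_max (Suc m) (T(u := ps @ Suc m # qs)) v = T v"
    using f[of u] f[of v] assms(2) by (auto simp: delete_max_fun)
qed

lemma delete_max_split:
  assumes "T \<in> inc_trees (Suc m)"
  obtains u ps qs where "delete_max (Suc m) T \<in> inc_trees m" "delete_max (Suc m) T u = ps @ qs"
    "u \<le> m" "T = (delete_max (Suc m) T)(u := ps @ Suc m # qs)"
proof -
  let ?n = "Suc m" let ?D = "delete_max (Suc m) T"
  obtain u ps qs where s: "T u = ps @ ?n # qs"
    using inc_trees_child_split[OF assms, of ?n] by auto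
  have "?n \<notin> set ps" "?n \<notin> set qs"
    using inc_trees_distinct[OF assms, of u] s by auto
  then have Du: "?D u = ps @ qs"
    using s by (simp add: delete_max_fun) (metis (mono_tags, lifting) filter_True)
  have Dv: "?D v = T v" if "v \<noteq> u" for v
  proof -
    have "?n \<notin> set (T v)" using inc_trees_parent_unique[OF assms, of ?n u v] s that by auto
    then show ?thesis by (simp add: delete_max_fun) (metis (mono_tags, lifting) filter_True)
  qed
  have mem: "x \<in> set (?D v) \<longleftrightarrow> x \<in> set (T v) \<and> x \<noteq> ?n" for x v by (auto simp: delete_max_fun)
  have "?D \<in> inc_trees m"
  proof (rule inc_treesI)
    show "distinct (?D v)" for v using inc_trees_distinct[OF assms] by (simp add: delete_max_fun)
    show "v < x \<and> x \<le> m" if "x \<in> set (?D v)" for x v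
      using that inc_trees_child[OF assms, of x v] unfolding mem by auto
    show "\<exists>w. v \<in> set (?D w)" if v: "1 \<le> v" "v \<le> m" for v
    proof -
      have "v \<le> Suc m" using v by simp
      then obtain w where "v \<in> set (T w)"
        using inc_trees_parent_exists[OF assms v(1)] by blast
      then have "v \<in> set (?D w)" unfolding mem using v by auto
      then show ?thesis ..
    qed
    show "x = y" if "v \<in> set (?D x)" "v \<in> set (?D y)" for v x y
      using that inc_trees_parent_unique[OF assms] unfolding mem by blast
  qed
  moreover have "u \<le> m" using inc_trees_child(1)[OF assms, of ?n u] s by simp
  moreover have "T = ?D(u := ps @ ?n # qs)" using s Dv by auto
  ultimately show ?thesis using that Du by blast
qed

text \<open>
  The site \<open>Inl u\<close> makes \<open>n\<close> the rightmost child of \<open>u\<close>, the site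
  \<open>Inr j\<close> makes it the left neighbor of \<open>j\<close>. The second formula acts on all child lists,
  which avoids naming the parent of \<open>j\<close>.
\<close>

definition graft :: "nat \<Rightarrow> otree \<Rightarrow> nat + nat \<Rightarrow> otree" where
  "graft n T p = (case p of
     Inl u \<Rightarrow> T(u := T u @ [n])
   | Inr j \<Rightarrow> (\<lambda>v. concat (map (\<lambda>x. if x = j then [n, j] else [x]) (T v))))"

abbreviation graft_sites :: "nat \<Rightarrow> (nat + nat) set" where
  "graft_sites m \<equiv> {0..m} <+> {1..m}"

lemma graft_Inr:
  assumes "T \<in> inc_trees m" "T w = ps @ j # qs"
  shows "graft n T (Inr j) = T(w := ps @ n # j # qs)"
proof
  have c: "concat (map (\<lambda>x. if x = j then [n, j] else [x]) xs) = xs" if "j \<notin> set xs" for xs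
    using that by (induction xs) auto
  fix v
  have "j \<notin> set ps" "j \<notin> set qs" using inc_trees_distinct[OF assms(1), of w] assms(2) by auto
  moreover have "j \<notin> set (T v)" if "v \<noteq> w"
    using inc_trees_parent_unique[OF assms(1), of j v w] assms(2) that by auto
  ultimately show "graft n T (Inr j) v = (T(w := ps @ n # j # qs)) v"
    using assms(2) c by (cases "v = w") (simp_all add: graft_def)
qed

text \<open>
  Both kinds of sites are gaps in a child list; the gap determines the site, because the site is
  the entry to the right of the gap, or the parent if there is none.
\<close>

lemma graft_gap:
  assumes "T \<in> inc_trees m" "p \<in> graft_sites m"
  obtains u ps qs where "T u = ps @ qs" "u \<le> m" "graft n T p = T(u := ps @ n # qs)"
    "p = (case qs of [] \<Rightarrow> Inl u | j # _ \<Rightarrow> Inr j)"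
proof (cases p)
  case (Inl u)
  show ?thesis by (rule that[of u "T u" "[]"]) (use Inl assms(2) in \<open>auto simp: graft_def\<close>)
next
  case (Inr j)
  then have "1 \<le> j" "j \<le> m" using assms(2) by auto
  then obtain w ps qs where s: "T w = ps @ j # qs" using inc_trees_child_split[OF assms(1)] by blast
  have "w \<le> m" using inc_trees_child[OF assms(1), of j w] s by auto
  then show ?thesis
    using that[of w ps "j # qs"] s graft_Inr[OF assms(1) s] Inr by auto
qed

lemma graft_inc_trees:
  assumes "T \<in> inc_trees m" "p \<in> graft_sites m"
  shows "graft (Suc m) T p \<in> inc_trees (Suc m)"
  by (rule graft_gap[OF assms, of "Suc m"]) (metis insert_max_inc_trees assms(1))

lemma delete_max_graft:
  assumes "T \<in> inc_trees m" "p \<in> graft_sites m"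
  shows "delete_max (Suc m) (graft (Suc m) T p) = T"
  by (rule graft_gap[OF assms, of "Suc m"]) (metis delete_insert_max assms(1))

lemma graft_bij:
  "bij_betw (\<lambda>(T, p). graft (Suc m) T p) (inc_trees m \<times> graft_sites m) (inc_trees (Suc m))"
proof (rule bij_betwI')
  fix x y assume x: "x \<in> inc_trees m \<times> graft_sites m" and y: "y \<in> inc_trees m \<times> graft_sites m"
  obtain T p T' p' where xy: "x = (T, p)" "y = (T', p')" by (cases x, cases y)
  then have T: "T \<in> inc_trees m" "p \<in> graft_sites m" and T': "T' \<in> inc_trees m" "p' \<in> graft_sites m"
    using x y by auto
  have "T = T' \<and> p = p'" if e: "graft (Suc m) T p = graft (Suc m) T' p'"
  proof
    show "T = T'" using delete_max_graft[OF T] delete_max_graft[OF T'] e by simp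
    obtain u ps qs where 1: "graft (Suc m) T p = T(u := ps @ Suc m # qs)"
      "p = (case qs of [] \<Rightarrow> Inl u | j # _ \<Rightarrow> Inr j)" by (rule graft_gap[OF T])
    obtain u' ps' qs' where 2: "graft (Suc m) T' p' = T'(u' := ps' @ Suc m # qs')"
      "p' = (case qs' of [] \<Rightarrow> Inl u' | j # _ \<Rightarrow> Inr j)" by (rule graft_gap[OF T'])
    have "graft (Suc m) T p u = ps @ Suc m # qs" using 1(1) by simp
    moreover have "graft (Suc m) T p u' = ps' @ Suc m # qs'" unfolding e 2(1) by simp
    ultimately have "u = u'" "qs = qs'"
      by (rule sibling_split_unique[OF graft_inc_trees[OF T]])+
    then show "p = p'" using 1(2) 2(2) by (simp only:)
  qed
  then show "((case x of (T, p) \<Rightarrow> graft (Suc m) T p) = (case y of (T, p) \<Rightarrow> graft (Suc m) T p))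
      = (x = y)" using xy by auto
next
  fix x assume "x \<in> inc_trees m \<times> graft_sites m"
  then show "(case x of (T, p) \<Rightarrow> graft (Suc m) T p) \<in> inc_trees (Suc m)"
    using graft_inc_trees by auto
next
  fix T assume T: "T \<in> inc_trees (Suc m)"
  let ?D = "delete_max (Suc m) T"
  obtain u ps qs where D: "?D \<in> inc_trees m" "?D u = ps @ qs" "u \<le> m"
    "T = ?D(u := ps @ Suc m # qs)" using delete_max_split[OF T] .
  show "\<exists>x\<in>inc_trees m \<times> graft_sites m. T = (case x of (T, p) \<Rightarrow> graft (Suc m) T p)"
  proof (cases qs)
    case Nil
    then have "T = graft (Suc m) ?D (Inl u)" using D(2,4) by (simp add: graft_def)
    then show ?thesis using D(1,3) by (intro bexI[of _ "(?D, Inl u)"]) auto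
  next
    case (Cons j qs')
    then have "T = graft (Suc m) ?D (Inr j)" using D graft_Inr[OF D(1), of u ps j qs'] by simp
    moreover have "0 < j" "j \<le> m" using inc_trees_child[OF D(1), of j u] D(2) Cons by auto
    ultimately show ?thesis using D(1) by (intro bexI[of _ "(?D, Inr j)"]) auto
  qed
qed

section \<open>Transferring a segment between siblings and children\<close>

text \<open>
  The two configurations that \<open>F\<close> exchanges around \<open>j\<close>, with parent \<open>w\<close>:
  in \<open>T\<close> the segment \<open>B1 @ [a]\<close> is the beginning of the big cohort of \<open>j\<close>, in
  \<open>T'\<close> it is the beginning of the list of children of \<open>j\<close>. The inequalities make
  \<open>a\<close> the associate of \<open>j\<close> in \<open>T\<close> and the smallest child of \<open>j\<close> in
  \<open>T'\<close>.
\<close>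

locale transfer =
  fixes T T' :: otree and w j :: nat and X B1 :: "nat list" and a :: nat and B2 Z :: "nat list"
  assumes before: "T w = X @ B1 @ a # B2 @ j # Z"
    and T'_def: "T' = T(w := X @ B2 @ j # Z, j := B1 @ a # T j)"
    and parent_neq: "w \<noteq> j"
    and blocked: "X = [] \<or> last X < j"
    and j_less: "j < a"
    and a_less: "\<forall>b\<in>set B1 \<union> set B2 \<union> set (T j). a < b"
begin

lemma a_lessD:
  "b \<in> set B1 \<Longrightarrow> a < b" "b \<in> set B2 \<Longrightarrow> a < b" "b \<in> set (T j) \<Longrightarrow> a < b"
  using a_less by auto

lemma j_lessD: "b \<in> set B1 \<Longrightarrow> j < b" "b \<in> set B2 \<Longrightarrow> j < b" "b \<in> set (T j) \<Longrightarrow> j < b"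
  using a_lessD j_less order.strict_trans by blast+

lemma after: "T' w = X @ B2 @ j # Z" "T' j = B1 @ a # T j"
  "\<And>u. u \<noteq> w \<Longrightarrow> u \<noteq> j \<Longrightarrow> T' u = T u"
  using parent_neq by (auto simp: T'_def)

lemma mem_after:
  "v \<in> set (T' u) \<longleftrightarrow> u = j \<and> v \<in> insert a (set B1) \<or>
     v \<in> set (T u) \<and> (u = w \<longrightarrow> v \<in> set X \<union> set B2 \<union> insert j (set Z))"
  using parent_neq before by (auto simp: T'_def)

lemma mem_before:
  "v \<in> set (T u) \<longleftrightarrow> u = w \<and> v \<in> insert a (set B1) \<or>
     v \<in> set (T' u) \<and> (u = j \<longrightarrow> v \<in> set (T j))"
  using parent_neq before by (auto simp: T'_def)

lemma inc_trees_after: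
  assumes T: "T \<in> inc_trees n"
  shows "T' \<in> inc_trees n"
proof (rule inc_treesI)
  have d: "distinct (X @ B1 @ a # B2 @ j # Z)" using inc_trees_distinct[OF T, of w] before by simp
  have up: "u = w" if "v \<in> set (T u)" "v \<in> insert a (set B1)" for u v
    using inc_trees_parent_unique[OF T that(1), of w] that(2) before by auto
  have dj: "distinct (B1 @ a # T j)"
    using d inc_trees_distinct[OF T, of j] up[of _ j] parent_neq by auto
  show "distinct (T' u)" for u
    using d dj inc_trees_distinct[OF T, of u] after by (cases "u = w"; cases "u = j") auto
  show "u < v \<and> v \<le> n" if "v \<in> set (T' u)" for u v
  proof (cases "u = j \<and> v \<in> insert a (set B1)")
    case True
    then have "v \<in> set (T w)" using before by auto
    then have "v \<le> n" using inc_trees_child(2)[OF T] by blast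
    then show ?thesis using True j_less j_lessD(1) by auto
  next
    case False
    then have "v \<in> set (T u)" using that mem_after by blast
    then show ?thesis using inc_trees_child[OF T] by blast
  qed
  show "\<exists>u. v \<in> set (T' u)" if v: "1 \<le> v" "v \<le> n" for v
  proof -
    obtain u where "v \<in> set (T u)" using inc_trees_parent_exists[OF T v] .
    then show ?thesis using mem_before[of v u] mem_after[of v j] by blast
  qed
  show "x = y" if "v \<in> set (T' x)" "v \<in> set (T' y)" for v x y
  proof (cases "v \<in> insert a (set B1)")
    case True
    have "z = j" if "v \<in> set (T' z)" for z
    proof (rule ccontr)
      assume z: "z \<noteq> j"
      then have "v \<in> set (T z)" using that mem_after by blast
      then have "z = w" using up True by blast
      then have "v \<in> set X \<union> set B2 \<union> insert j (set Z)" using that z after(1) by auto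
      then show False using True d by auto
    qed
    then show ?thesis using that by blast
  next
    case False
    then have "v \<in> set (T x)" "v \<in> set (T y)" using that mem_after by blast+
    then show ?thesis using inc_trees_parent_unique[OF T] by blast
  qed
qed

lemma inc_trees_before:
  assumes T': "T' \<in> inc_trees n"
  shows "T \<in> inc_trees n"
proof (rule inc_treesI)
  have d: "distinct (X @ B2 @ j # Z)" using inc_trees_distinct[OF T', of w] after by simp
  have dj: "distinct (B1 @ a # T j)" using inc_trees_distinct[OF T', of j] after by simp
  have up: "u = j" if "v \<in> set (T' u)" "v \<in> insert a (set B1)" for u v
    using inc_trees_parent_unique[OF T' that(1), of j] that(2) after(2) by auto
  have dw: "distinct (X @ B1 @ a # B2 @ j # Z)"
    using d dj up[of _ w] parent_neq after(1) j_less a_less by auto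
  show "distinct (T u)" for u
    using dw dj inc_trees_distinct[OF T', of u] after before by (cases "u = w"; cases "u = j") auto
  have wj: "w < j" using inc_trees_child(1)[OF T', of j w] after(1) by simp
  show "u < v \<and> v \<le> n" if "v \<in> set (T u)" for u v
  proof (cases "u = w \<and> v \<in> insert a (set B1)")
    case True
    then have "v \<in> set (T' j)" using after(2) by auto
    then show ?thesis using True inc_trees_child[OF T', of v j] wj by auto
  next
    case False
    then have "v \<in> set (T' u)" using that mem_before by blast
    then show ?thesis using inc_trees_child[OF T'] by blast
  qed
  show "\<exists>u. v \<in> set (T u)" if v: "1 \<le> v" "v \<le> n" for v
  proof -
    obtain u where "v \<in> set (T' u)" using inc_trees_parent_exists[OF T' v] .
    then show ?thesis using mem_after[of v u] mem_before[of v w] by blast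
  qed
  show "x = y" if "v \<in> set (T x)" "v \<in> set (T y)" for v x y
  proof (cases "v \<in> insert a (set B1)")
    case True
    have "z = w" if "v \<in> set (T z)" for z
    proof (rule ccontr)
      assume z: "z \<noteq> w"
      then have "v \<in> set (T' z)" using that mem_before by blast
      then have "z = j" using up True by blast
      then show False using that True dj by auto
    qed
    then show ?thesis using that by blast
  next
    case False
    then have "v \<in> set (T' x)" "v \<in> set (T' y)" using that mem_before by blast+
    then show ?thesis using inc_trees_parent_unique[OF T'] by blast
  qed
qed

end

text \<open>
  The transfers of \<open>map_F\<close> around a given vertex \<open>j\<close>, freed from the vertex
  \<open>n\<close>. Hence it applies to the tree from which \<open>n\<close> has been deleted.
\<close>

definition toggle :: "nat \<Rightarrow> otree \<Rightarrow> otree" where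
  "toggle j T = (let w = parent T j in
       if KV T j then
         let a = associate T j; seg = big_cohort T a @ [a]
         in T(w := filter (\<lambda>x. x \<notin> set seg) (T w), j := seg @ T j)
       else
         let c = Min (set (T j)); seg = cohort T c @ [c];
             pre = take (length (cohort T j) - length (big_cohort T j)) (T w)
         in T(w := pre @ seg @ drop (length pre) (T w),
              j := drop (length seg) (T j)))"

locale tree_transfer = transfer +
  fixes n :: nat
  assumes T: "T \<in> inc_trees n"
begin

lemma T': "T' \<in> inc_trees n" using T inc_trees_after by blast

lemma before_j: "T w = (X @ B1 @ a # B2) @ j # Z" and before_a: "T w = (X @ B1) @ a # (B2 @ j # Z)"
  and after_j: "T' w = (X @ B2) @ j # Z"
  using before after by auto

lemma run_before: "larger_suffix j (X @ B1 @ a # B2) = B1 @ a # B2"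
proof -
  have "larger_suffix j (X @ B1 @ a # B2) = larger_suffix j (B1 @ a # B2)"
    by (rule larger_suffix_blocked) (use blocked in auto)
  also have "\<dots> = B1 @ a # B2"
    by (rule larger_suffix_all) (auto simp: j_less j_lessD)
  finally show ?thesis .
qed

lemma run_after: "larger_suffix j (X @ B2) = B2"
proof -
  have "larger_suffix j (X @ B2) = larger_suffix j B2"
    by (rule larger_suffix_blocked) (use blocked in auto)
  also have "\<dots> = B2"
    by (rule larger_suffix_all) (auto simp: j_lessD)
  finally show ?thesis .
qed

lemma Min_before: "Min (set (B1 @ a # B2)) = a"
  by (rule Min_eqI) (auto dest: a_lessD)

lemma associate_before: "associate T j = a"
  unfolding associate_def big_cohort_eq[OF T before_j] run_before by (rule Min_before)

lemma KV_before: "KV T j"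
  unfolding KV_iff[OF T before_j] run_before Min_before using a_less by simp

text \<open>
  The child \<open>a\<close> of \<open>j\<close> is smaller than everything that is left of the big cohort.
\<close>

lemma not_KV_after: "\<not> KV T' j"
proof -
  have "\<not> Min (set B2) < a" if "B2 \<noteq> []" using that by (auto simp: a_lessD not_less less_imp_le)
  then show ?thesis
    unfolding KV_iff[OF T' after_j] run_after after(2) by auto
qed

lemma toggle_before: "toggle j T = T'"
proof -
  have p: "parent T j = w" by (rule parent_eq[OF T]) (simp add: before)
  have "larger_suffix a (X @ B1) = larger_suffix a B1"
    by (rule larger_suffix_blocked) (use blocked j_less in auto)
  also have "\<dots> = B1" using larger_suffix_append[of a "[]" B1] a_less by auto
  finally have seg: "big_cohort T a = B1" by (simp add: big_cohort_eq[OF T before_a])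
  let ?keep = "filter (\<lambda>x. x \<notin> set (B1 @ [a]))"
  have "distinct (X @ B1 @ a # B2 @ j # Z)" using inc_trees_distinct[OF T, of w] before by simp
  then have "?keep X = X" "?keep B2 = B2" "?keep (j # Z) = j # Z"
    by (intro filter_True; auto)+
  moreover have "?keep (B1 @ [a]) = []" by simp
  moreover have "T w = X @ (B1 @ [a]) @ B2 @ j # Z" by (simp add: before)
  ultimately have "?keep (T w) = X @ B2 @ j # Z" by (simp only: filter_append append_Nil)
  then show ?thesis
    unfolding toggle_def T'_def Let_def p associate_before seg using KV_before by simp
qed

lemma toggle_after: "toggle j T' = T"
proof -
  have p: "parent T' j = w" by (rule parent_eq[OF T']) (simp add: after)
  have c: "Min (set (T' j)) = a" unfolding after by (rule Min_eqI) (auto dest: a_lessD)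
  have seg: "cohort T' a = B1" by (rule cohort_eq[OF T' after(2)])
  have pre: "take (length (cohort T' j) - length (big_cohort T' j)) (T' w) = X"
    unfolding cohort_eq[OF T' after_j] big_cohort_eq[OF T' after_j] run_after by (simp add: after)
  have "toggle j T' = T'(w := X @ (B1 @ [a]) @ drop (length X) (T' w),
      j := drop (length (B1 @ [a])) (T' j))"
    unfolding toggle_def Let_def p c seg pre using not_KV_after by simp
  also have "\<dots> = T"
  proof
    fix u
    show "(T'(w := X @ (B1 @ [a]) @ drop (length X) (T' w),
      j := drop (length (B1 @ [a])) (T' j))) u = T u"
      using parent_neq before after by (cases "u = j"; cases "u = w") auto
  qed
  finally show ?thesis .
qed

lemma children_same_Min_last:
  assumes "i \<noteq> j"
  shows "same_Min_last (T i) (T' i)"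
proof (cases "i = w")
  case True
  have "same_Min_last (X @ (B1 @ [a]) @ B2 @ j # Z) (X @ B2 @ j # Z)"
    by (rule same_Min_last_delete) (auto simp: j_less j_lessD)
  then show ?thesis unfolding True after before by simp
qed (use assms after in simp)

text \<open>
  Only lists that precede \<open>i\<close> or consist of children of \<open>i\<close> matter, so the proof goes
  through the possible places of \<open>i\<close>. In the blocks \<open>B1\<close>, \<open>a\<close>,
  \<open>B2\<close> and in the children of \<open>j\<close>, the big cohort of \<open>i\<close> cannot extend to
  the left of the block, because a smaller entry stands there before and after the transfer. For
  \<open>i\<close> to the right of \<open>j\<close>, and for the children of \<open>w\<close>, the presence of
  \<open>j\<close> makes the larger entries of the moved segment irrelevant.
\<close>

lemma other_KV:
  assumes "i \<noteq> j"
  shows "(KV T i \<longleftrightarrow> KV T' i) \<and> (KV T i \<longrightarrow> partner T i = partner T' i)"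
proof -
  have goal: ?thesis if "T u = ps @ i # qs" "T' u' = ps' @ i # qs'"
    "same_Min_last (larger_suffix i ps) (larger_suffix i ps')" for u ps qs u' ps' qs'
    using KV_partner_cong[OF T T' that children_same_Min_last[OF assms]] by blast
  \<comment> \<open>All entries of the blocks between \<open>X\<close> and \<open>j\<close> exceed \<open>j\<close>, so \<open>X\<close> blocks them.\<close>
  have blk: "X = [] \<or> last X \<le> b" if "j < b" for b using blocked that by auto
  consider "\<forall>u. i \<notin> set (T u)" | "i \<in> set X" | "i \<in> set B1" | "i = a" | "i \<in> set B2" | "i \<in> set Z"
    | "i \<in> set (T j)" | u where "i \<in> set (T u)" "u \<noteq> w" "u \<noteq> j"
  proof (cases "i \<in> set (T w)")
    case True
    then show ?thesis using that(2-6) assms unfolding before by auto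
  qed (use that(1,7,8) in blast)
  then show ?thesis
  proof cases
    case 1
    then have "i \<notin> set (T w)" by blast
    then have "i \<notin> insert a (set B1)" unfolding before by simp
    then have "i \<notin> set (T' u)" for u using 1 mem_after[of i u] by blast
    then have "\<not> KV T' i" using KV_has_parent[OF T'] by metis
    moreover have "\<not> KV T i" using 1 KV_has_parent[OF T] by metis
    ultimately show ?thesis by blast
  next
    case 2
    then obtain X1 X2 where "X = X1 @ i # X2" by (meson split_list)
    then show ?thesis
      by (intro goal[of w X1 "X2 @ B1 @ a # B2 @ j # Z" w X1 "X2 @ B2 @ j # Z"])
        (simp_all add: before after)
  next
    case 3
    then obtain Y1 Y2 where B1: "B1 = Y1 @ i # Y2" by (meson split_list)
    have "larger_suffix i (X @ Y1) = larger_suffix i Y1"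
      by (rule larger_suffix_blocked, rule blk, rule j_lessD(1)[OF 3])
    then show ?thesis
      by (intro goal[of w "X @ Y1" "Y2 @ a # B2 @ j # Z" j Y1 "Y2 @ a # T j"])
        (simp_all add: before after B1)
  next
    case 4
    have "larger_suffix i (X @ B1) = larger_suffix i B1"
      unfolding 4 by (rule larger_suffix_blocked, rule blk, rule j_less)
    then show ?thesis
      by (intro goal[of w "X @ B1" "B2 @ j # Z" j B1 "T j"]) (simp_all add: before after 4)
  next
    case 5
    then obtain Y1 Y2 where B2: "B2 = Y1 @ i # Y2" by (meson split_list)
    have "larger_suffix i ((X @ B1 @ [a]) @ Y1) = larger_suffix i Y1"
      by (rule larger_suffix_blocked) (use a_lessD(2)[OF 5] in simp)
    moreover have "larger_suffix i (X @ Y1) = larger_suffix i Y1"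
      by (rule larger_suffix_blocked, rule blk, rule j_lessD(2)[OF 5])
    ultimately show ?thesis
      by (intro goal[of w "(X @ B1 @ [a]) @ Y1" "Y2 @ j # Z" w "X @ Y1" "Y2 @ j # Z"])
        (simp_all add: before after B2)
  next
    case 6
    then obtain Z1 Z2 where Z: "Z = Z1 @ i # Z2" by (meson split_list)
    have "same_Min_last (larger_suffix i (X @ (B1 @ [a]) @ B2 @ j # Z1)) (larger_suffix i (X @ B2 @ j # Z1))"
      by (rule same_Min_last_larger_suffix) (auto simp: j_less j_lessD)
    then show ?thesis
      by (intro goal[of w "X @ (B1 @ [a]) @ B2 @ j # Z1" Z2 w "X @ B2 @ j # Z1" Z2])
        (simp_all add: before after Z)
  next
    case 7
    then obtain Y1 Y2 where Tj: "T j = Y1 @ i # Y2" by (meson split_list)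
    have "larger_suffix i ((B1 @ [a]) @ Y1) = larger_suffix i Y1"
      by (rule larger_suffix_blocked) (use a_lessD(3)[OF 7] in simp)
    then show ?thesis
      by (intro goal[of j Y1 Y2 j "(B1 @ [a]) @ Y1" Y2]) (simp_all add: after Tj)
  next
    case (8 u)
    then obtain ps qs where "T u = ps @ i # qs" by (meson split_list)
    then show ?thesis using after(3)[OF 8(2,3)] by (intro goal[of u ps qs u ps qs]) simp_all
  qed
qed

text \<open>
  A new left neighbor \<open>k\<close> of \<open>j\<close> only prolongs \<open>B2\<close>. This is why
  \<open>F\<close> commutes with the deletion of the largest vertex.
\<close>

lemma graft_transfer:
  assumes "a < k"
  shows "transfer (graft k T (Inr j)) (graft k T' (Inr j)) w j X B1 a (B2 @ [k]) Z"
proof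
  have gT: "graft k T (Inr j) = T(w := (X @ B1 @ a # B2) @ k # j # Z)"
    by (rule graft_Inr[OF T before_j])
  have gT': "graft k T' (Inr j) = T'(w := (X @ B2) @ k # j # Z)"
    by (rule graft_Inr[OF T' after_j])
  show "graft k T (Inr j) w = X @ B1 @ a # (B2 @ [k]) @ j # Z" by (simp add: gT)
  show "graft k T' (Inr j) = (graft k T (Inr j))
      (w := X @ (B2 @ [k]) @ j # Z, j := B1 @ a # graft k T (Inr j) j)"
    using parent_neq unfolding gT gT' by (auto simp: T'_def)
  show "\<forall>b\<in>set B1 \<union> set (B2 @ [k]) \<union> set (graft k T (Inr j) j). a < b"
    using a_less assms parent_neq unfolding gT by auto
qed (use parent_neq blocked j_less in auto)

end

lemma split_at_Min:
  fixes xs :: "nat list"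
  assumes "distinct xs" "xs \<noteq> []"
  obtains ys a zs where "xs = ys @ a # zs" "Min (set xs) = a" "\<forall>b\<in>set ys \<union> set zs. a < b"
proof -
  define a where "a = Min (set xs)"
  have "a \<in> set xs" using assms(2) by (simp add: a_def)
  then obtain ys zs where xs: "xs = ys @ a # zs" by (meson split_list)
  have "a < b" if b: "b \<in> set ys \<union> set zs" for b
  proof -
    have "b \<in> set xs" using b xs by auto
    then have "a \<le> b" by (simp add: a_def)
    moreover have "a \<noteq> b" using b assms(1) xs by auto
    ultimately show ?thesis by simp
  qed
  then show ?thesis using that[OF xs] a_def by blast
qed

lemma blocking_prefix:
  assumes "T \<in> inc_trees n" "T w = ps @ j # Z"
  obtains X where "ps = X @ larger_suffix j ps" "X = [] \<or> last X < j"
proof -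
  obtain X where X: "ps = X @ larger_suffix j ps" "X = [] \<or> last X \<le> j"
    by (rule larger_suffix_split)
  have "last X \<noteq> j" if "X \<noteq> []"
  proof -
    have "last X \<in> set ps" using that X(1) by (metis Un_iff last_in_set set_append)
    then show ?thesis using inc_trees_distinct[OF assms(1), of w] assms(2) by auto
  qed
  then have "X = [] \<or> last X < j" using X(2) by force
  then show ?thesis using X(1) that by blast
qed

text \<open>
  Split the big cohort of \<open>j\<close> at its minimum, the associate; as \<open>j\<close> is a KV, the
  associate is smaller than the children of \<open>j\<close>.
\<close>

lemma KV_transfer:
  assumes T: "T \<in> inc_trees n" and "KV T j"
  obtains T' w X B1 a B2 Z where "tree_transfer T T' w j X B1 a B2 Z n"
proof -
  obtain w ps Z where s: "T w = ps @ j # Z" using KV_child[OF assms] .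
  define r where "r = larger_suffix j ps"
  obtain X where X: "ps = X @ r" "X = [] \<or> last X < j"
    using blocking_prefix[OF T s] unfolding r_def .
  have ne: "r \<noteq> []" and c: "\<forall>c\<in>set (T j). Min (set r) < c"
    using assms(2) KV_iff[OF T s] by (auto simp: r_def)
  have "distinct r" using inc_trees_distinct[OF T, of w] by (simp add: s X(1))
  then obtain B1 a B2 where B: "r = B1 @ a # B2" "Min (set r) = a" "\<forall>b\<in>set B1 \<union> set B2. a < b"
    using ne by (rule split_at_Min)
  have "\<forall>y\<in>set r. j < y" unfolding r_def by (rule larger_suffix_split)
  then have "j < a" by (simp add: B(1))
  moreover have "w \<noteq> j" using inc_trees_child(1)[OF T, of j w] s by auto
  moreover have "\<forall>b\<in>set B1 \<union> set B2 \<union> set (T j). a < b" using B(3) c unfolding B(2) by blast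
  moreover have "T w = X @ B1 @ a # B2 @ j # Z" by (simp add: s X(1) B(1))
  ultimately have "tree_transfer T (T(w := X @ B2 @ j # Z, j := B1 @ a # T j)) w j X B1 a B2 Z n"
    using T X(2) by unfold_locales simp_all
  then show ?thesis by (rule that)
qed

text \<open>
  Split the list of children at its minimum \<open>a\<close>. As \<open>j\<close> is not a KV, \<open>a\<close> is at
  most the minimum of the big cohort of \<open>j\<close>, and it differs from its entries because they have
  another parent.
\<close>

lemma not_KV_transfer:
  assumes T': "T' \<in> inc_trees n" and "1 \<le> j" "j \<le> n" "\<not> KV T' j" "T' j \<noteq> []"
  obtains T w X B1 a B2 Z where "tree_transfer T T' w j X B1 a B2 Z n"
proof -
  obtain w ps Z where s: "T' w = ps @ j # Z"
    using inc_trees_child_split[OF T' assms(2,3)] .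
  define r where "r = larger_suffix j ps"
  obtain X where X: "ps = X @ r" "X = [] \<or> last X < j"
    using blocking_prefix[OF T' s] unfolding r_def .
  have w: "T' w = X @ r @ j # Z" by (simp add: s X(1))
  have wj: "w \<noteq> j" using inc_trees_child(1)[OF T', of j w] s by auto
  obtain B1 a C where B: "T' j = B1 @ a # C" "Min (set (T' j)) = a" "\<forall>b\<in>set B1 \<union> set C. a < b"
    using inc_trees_distinct[OF T', of j] assms(5) by (rule split_at_Min)
  have a: "a \<in> set (T' j)" by (simp add: B(1))
  have "a < b" if b: "b \<in> set r" for b
  proof -
    have "r \<noteq> []" using b by auto
    then have "\<exists>c\<in>set (T' j). c \<le> Min (set r)"
      using assms(4) unfolding KV_iff[OF T' s] r_def[symmetric]
      by (simp only: not_less simp_thms bex_simps ball_simps)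
    then obtain c where c: "c \<in> set (T' j)" "c \<le> Min (set r)" ..
    have "a \<le> c" using c(1) by (simp add: B(2)[symmetric])
    also note c(2)
    also have "Min (set r) \<le> b" using b by simp
    finally have "a \<le> b" .
    moreover have "b \<in> set (T' w)" using b w by simp
    then have "a \<noteq> b" using inc_trees_parent_unique[OF T' a, of w] wj by blast
    ultimately show ?thesis by simp
  qed
  then have "\<forall>b\<in>set B1 \<union> set r \<union> set C. a < b" using B(3) by blast
  moreover have "j < a" using inc_trees_child(1)[OF T' a] .
  ultimately have t: "transfer (T'(w := X @ B1 @ a # r @ j # Z, j := C)) T' w j X B1 a r Z"
    using B(1) X(2) wj w by unfold_locales (simp_all add: fun_eq_iff)
  then have "tree_transfer (T'(w := X @ B1 @ a # r @ j # Z, j := C)) T' w j X B1 a r Z n"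
    using transfer.inc_trees_before[OF t T'] by (intro tree_transfer.intro tree_transfer_axioms.intro)
  then show ?thesis by (rule that)
qed

lemma toggle_KV:
  assumes T: "T \<in> inc_trees n" and "KV T j"
  shows "toggle j T \<in> inc_trees n" "\<not> KV (toggle j T) j" "toggle j T j \<noteq> []"
    "toggle j (toggle j T) = T"
proof -
  obtain T' w X B1 a B2 Z where "tree_transfer T T' w j X B1 a B2 Z n"
    using KV_transfer[OF assms] .
  then interpret tree_transfer T T' w j X B1 a B2 Z n .
  show "toggle j T \<in> inc_trees n" "\<not> KV (toggle j T) j" "toggle j T j \<noteq> []"
    "toggle j (toggle j T) = T"
    unfolding toggle_before by (simp_all add: T' not_KV_after after toggle_after)
qed

lemma toggle_not_KV:
  assumes T: "T \<in> inc_trees n" and "1 \<le> j" "j \<le> n" "\<not> KV T j" "T j \<noteq> []"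
  shows "toggle j T \<in> inc_trees n" "KV (toggle j T) j" "toggle j (toggle j T) = T"
proof -
  obtain T0 w X B1 a B2 Z where "tree_transfer T0 T w j X B1 a B2 Z n"
    using not_KV_transfer[OF assms] .
  then interpret t: tree_transfer T0 T w j X B1 a B2 Z n .
  show "toggle j T \<in> inc_trees n" "KV (toggle j T) j" "toggle j (toggle j T) = T"
    unfolding t.toggle_after by (simp_all add: t.T t.KV_before t.toggle_before)
qed

lemma toggle_other_KV:
  assumes T: "T \<in> inc_trees n" and j: "1 \<le> j" "j \<le> n" "KV T j \<or> T j \<noteq> []" and "i \<noteq> j"
  shows "(KV (toggle j T) i \<longleftrightarrow> KV T i) \<and> (KV T i \<longrightarrow> partner (toggle j T) i = partner T i)"
proof (cases "KV T j")
  case True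
  obtain T' w X B1 a B2 Z where "tree_transfer T T' w j X B1 a B2 Z n"
    using KV_transfer[OF T True] .
  then interpret tree_transfer T T' w j X B1 a B2 Z n .
  show ?thesis using other_KV[OF assms(5)] unfolding toggle_before by auto
next
  case False
  then obtain T0 w X B1 a B2 Z where "tree_transfer T0 T w j X B1 a B2 Z n"
    using not_KV_transfer[OF T j(1,2)] j(3) by blast
  then interpret t: tree_transfer T0 T w j X B1 a B2 Z n .
  show ?thesis using t.other_KV[OF assms(5)] unfolding t.toggle_after by auto
qed

text \<open>
  The excluded case, \<open>n\<close> being the associate of a KV \<open>j\<close>, is the one in which
  \<open>map_F\<close> leaves the tree unchanged.
\<close>

lemma map_F_toggle:
  assumes T: "T \<in> inc_trees n" and s: "T w = ps @ n # j # qs" and a: "KV T j \<Longrightarrow> associate T j \<noteq> n"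
  shows "map_F n T = toggle j T"
proof -
  have l: "left_neighbor T n x \<longleftrightarrow> x = j" for x
    using s sibling_split_unique(3)[OF T s] unfolding left_neighbor_def by blast
  show ?thesis unfolding map_F_def toggle_def l Let_def using a by simp
qed

section \<open>Enlarging perfect matchings\<close>

definition matching_on :: "nat set \<Rightarrow> diagram \<Rightarrow> bool" where
  "matching_on A M \<longleftrightarrow> partition_on A M \<and> (\<forall>e\<in>M. card e = 2)"

lemma perfect_matchings_iff: "M \<in> perfect_matchings n \<longleftrightarrow> matching_on {1..2 * n} M"
  by (simp add: perfect_matchings_def matching_on_def)

lemma matching_on_same_edge:
  assumes "matching_on A M" "e \<in> M" "f \<in> M" "x \<in> e" "x \<in> f"
  shows "e = f"
  using assms unfolding matching_on_def partition_on_def disjoint_def by blast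

lemma matching_on_subset: "matching_on A M \<Longrightarrow> e \<in> M \<Longrightarrow> e \<subseteq> A"
  unfolding matching_on_def partition_on_def by blast

lemma matching_on_edge_neq: "matching_on A M \<Longrightarrow> {x, y} \<in> M \<Longrightarrow> x \<noteq> y"
  unfolding matching_on_def by force

lemma matching_on_insert:
  assumes "matching_on A M" "x \<notin> A" "y \<notin> A" "x \<noteq> y"
  shows "matching_on (insert x (insert y A)) (insert {x, y} M)"
proof -
  have "partition_on (A \<union> {x, y}) (insert {x, y} M)"
    using assms by (auto simp: matching_on_def partition_on_def disjoint_def)
  then show ?thesis using assms by (auto simp: matching_on_def insert_commute)
qed

lemma matching_on_remove:
  assumes "matching_on A M" "{x, y} \<in> M"
  shows "matching_on (A - {x, y}) (M - {{x, y}})"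
proof -
  have "\<Union> (M - {{x, y}}) = A - {x, y}"
  proof (intro set_eqI iffI)
    fix z assume "z \<in> \<Union> (M - {{x, y}})"
    then obtain e where e: "e \<in> M" "e \<noteq> {x, y}" "z \<in> e" by blast
    then have "z \<notin> {x, y}" using matching_on_same_edge[OF assms(1) e(1) assms(2)] by blast
    then show "z \<in> A - {x, y}" using e matching_on_subset[OF assms(1)] by blast
  next
    fix z assume "z \<in> A - {x, y}"
    then show "z \<in> \<Union> (M - {{x, y}})"
      using assms(1) by (auto simp: matching_on_def partition_on_def)
  qed
  then show ?thesis
    using assms(1) by (auto simp: matching_on_def partition_on_def disjoint_def)
qed

lemma mate_eq:
  assumes "matching_on A M" "{x, y} \<in> M"
  shows "mate M x = y"
proof -
  have "z = y" if "{x, z} \<in> M" for z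
    using matching_on_same_edge[OF assms(1) that assms(2), of x]
    by (auto simp: doubleton_eq_iff)
  then show ?thesis unfolding mate_def using assms(2) by blast
qed

lemma mate_edge:
  assumes "matching_on A M" "x \<in> A"
  shows "{x, mate M x} \<in> M"
proof -
  obtain e where e: "e \<in> M" "x \<in> e"
    using assms unfolding matching_on_def partition_on_def by blast
  then have "card e = 2" using assms(1) by (simp add: matching_on_def)
  then obtain y where "e = {x, y}" using e(2) by (auto simp: card_2_iff)
  then have y: "{x, y} \<in> M" using e(1) by simp
  then show ?thesis by (simp add: mate_eq[OF assms(1) y])
qed

lemma mate_facts:
  assumes "matching_on A M" "x \<in> A"
  shows "mate M x \<in> A" "mate M x \<noteq> x"
proof -
  note e = mate_edge[OF assms]
  show "mate M x \<in> A" using matching_on_subset[OF assms(1) e] by simp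
  show "mate M x \<noteq> x" using matching_on_edge_neq[OF assms(1) e] by simp
qed

text \<open>
  Both ways of enlarging, with the new bottom dot standing for the enlargement that keeps all edges;
  this dot is not an old one, so there is no conflict.
\<close>

definition enlarge :: "nat \<Rightarrow> nat \<Rightarrow> diagram \<Rightarrow> diagram" where
  "enlarge n d M = (if d = bot_dot n then enlarge_new n M else enlarge_old n d M)"

abbreviation usable_dots :: "nat \<Rightarrow> nat set" where
  "usable_dots m \<equiv> insert (bot_dot (Suc m)) {1..2 * m}"

text \<open>
  The inverse reads off the used dot \<open>d\<close> as the mate of the new top dot. Unless \<open>d\<close>
  is the new bottom dot, its former mate is the mate of the new bottom dot, so the old edge can be
  restored.
\<close>

lemma enlarge_bij:
  "bij_betw (\<lambda>(M, d). enlarge (Suc m) d M)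
     (perfect_matchings m \<times> usable_dots m) (perfect_matchings (Suc m))"
proof -
  let ?t = "top_dot (Suc m)" and ?b = "bot_dot (Suc m)"
  let ?A = "{1..2 * m}" and ?B = "{1..2 * Suc m}"
  \<comment> \<open>Here \<open>d\<close> is the used dot and \<open>d'\<close> its mate before the enlargement.\<close>
  let ?shrink = "\<lambda>N. let d = mate N ?t; d' = mate N ?b in
     (if d = ?b then N - {{?t, ?b}} else insert {d, d'} (N - {{?t, d}} - {{d', ?b}}), d)"
  have tb: "?t \<notin> ?A" "?b \<notin> ?A" "?t \<noteq> ?b" and B: "?B = insert ?t (insert ?b ?A)"
    by (auto simp: top_dot_def bot_dot_def)
  have old: "matching_on ?B (enlarge_old (Suc m) d M)"
    "enlarge_old (Suc m) d M = insert {?t, d} (insert {mate M d, ?b} (M - {{d, mate M d}}))"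
    if M: "matching_on ?A M" and d: "d \<in> ?A" for M d
  proof -
    let ?e = "mate M d"
    show eq: "enlarge_old (Suc m) d M = insert {?t, d} (insert {?e, ?b} (M - {{d, ?e}}))"
      by (auto simp: enlarge_old_def)
    have e: "?e \<in> ?A" "?e \<noteq> d" using mate_facts[OF M d] .
    have 1: "matching_on (?A - {d, ?e}) (M - {{d, ?e}})"
      using matching_on_remove[OF M mate_edge[OF M d]] .
    have 2: "matching_on (insert ?e (insert ?b (?A - {d, ?e}))) (insert {?e, ?b} (M - {{d, ?e}}))"
      by (rule matching_on_insert[OF 1]) (use e tb in auto)
    have 3: "matching_on (insert ?t (insert d (insert ?e (insert ?b (?A - {d, ?e})))))
       (insert {?t, d} (insert {?e, ?b} (M - {{d, ?e}})))"
      by (rule matching_on_insert[OF 2]) (use e d tb in auto)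
    have "insert ?t (insert d (insert ?e (insert ?b (?A - {d, ?e})))) = ?B"
      unfolding B using e(1) d by blast
    then show "matching_on ?B (enlarge_old (Suc m) d M)" using 3 eq by simp
  qed
  have new: "matching_on ?B (insert {?t, ?b} M)" if M: "matching_on ?A M" for M
    unfolding B by (rule matching_on_insert[OF M tb])
  show ?thesis
  proof (rule bij_betw_byWitness[where f' = ?shrink])
    show "\<forall>x\<in>perfect_matchings m \<times> usable_dots m.
        ?shrink (case x of (M, d) \<Rightarrow> enlarge (Suc m) d M) = x"
    proof
      fix x assume "x \<in> perfect_matchings m \<times> usable_dots m"
      then obtain M d where x: "x = (M, d)" "matching_on ?A M" "d \<in> usable_dots m"
        by (auto simp: perfect_matchings_iff)
      have no: "e \<notin> M" if "e \<inter> {?t, ?b} \<noteq> {}" for e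
        using matching_on_subset[OF x(2), of e] tb that by blast
      show "?shrink (case x of (M, d) \<Rightarrow> enlarge (Suc m) d M) = x"
      proof (cases "d = ?b")
        case True
        then have "mate (insert {?t, ?b} M) ?t = d"
          using mate_eq[OF new[OF x(2)]] by simp
        then show ?thesis using x(1) True no[of "{?t, ?b}"]
          by (simp add: enlarge_def enlarge_new_def Let_def)
      next
        case False
        then have d: "d \<in> ?A" using x(3) by blast
        let ?e = "mate M d" and ?N = "enlarge_old (Suc m) d M"
        have N: "?N = insert {?t, d} (insert {?e, ?b} (M - {{d, ?e}}))" "matching_on ?B ?N"
          using old[OF x(2) d] by auto
        have e: "?e \<in> ?A" "?e \<noteq> d" using mate_facts[OF x(2) d] .
        have "{?t, d} \<in> ?N" "{?b, ?e} \<in> ?N" unfolding N(1) by auto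
        then have m: "mate ?N ?t = d" "mate ?N ?b = ?e" using mate_eq[OF N(2)] by blast+
        have "insert {d, ?e} (?N - {{?t, d}} - {{?e, ?b}}) = insert {d, ?e} M"
          unfolding N(1) using no[of "{?t, d}"] no[of "{?e, ?b}"] by auto
        also have "\<dots> = M" using mate_edge[OF x(2) d] by blast
        finally show ?thesis using x(1) False m by (simp add: enlarge_def Let_def)
      qed
    qed
    show "(\<lambda>(M, d). enlarge (Suc m) d M) ` (perfect_matchings m \<times> usable_dots m)
        \<subseteq> perfect_matchings (Suc m)"
    proof clarify
      fix M d assume M: "M \<in> perfect_matchings m" and d: "d \<in> usable_dots m"
      show "enlarge (Suc m) d M \<in> perfect_matchings (Suc m)"
        using M d new old(1) unfolding perfect_matchings_iff enlarge_def enlarge_new_def by auto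
    qed
    have expand: "?shrink N \<in> perfect_matchings m \<times> usable_dots m \<and>
        (case ?shrink N of (M, d) \<Rightarrow> enlarge (Suc m) d M) = N"
      if "N \<in> perfect_matchings (Suc m)" for N
    proof -
      have N: "matching_on ?B N" using that by (simp only: perfect_matchings_iff)
      have t: "?t \<in> ?B" and b: "?b \<in> ?B" unfolding B by auto
      let ?d = "mate N ?t" and ?e = "mate N ?b"
      have d: "{?t, ?d} \<in> N" "?d \<in> ?B" "?d \<noteq> ?t" using mate_edge[OF N t] mate_facts[OF N t] by auto
      have e: "{?b, ?e} \<in> N" "?e \<in> ?B" "?e \<noteq> ?b" using mate_edge[OF N b] mate_facts[OF N b] by auto
      show ?thesis
      proof (cases "?d = ?b")
        case True
        have "matching_on (?B - {?t, ?b}) (N - {{?t, ?b}})"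
          using matching_on_remove[OF N, of ?t ?b] d(1) True by simp
        moreover have "?B - {?t, ?b} = ?A" unfolding B using tb by blast
        ultimately show ?thesis using True d(1)
          by (simp add: perfect_matchings_iff Let_def enlarge_def enlarge_new_def insert_absorb)
      next
        case False
        have "?e \<noteq> ?t"
        proof
          assume "?e = ?t"
          then have "mate N ?t = ?b" using mate_eq[OF N, of ?t ?b] e(1) by (simp add: insert_commute)
          then show False using False by simp
        qed
        moreover have "?e \<noteq> ?d"
        proof
          assume "?e = ?d"
          then have "{?t, ?d} = {?b, ?e}"
            using matching_on_same_edge[OF N d(1) e(1), of ?d] by simp
          then have "?t \<in> {?b, ?e}" by (metis insertI1)
          then show False using tb(3) d(3) \<open>?e = ?d\<close> by simp
        qed
        ultimately have ne: "?d \<noteq> ?b" "?e \<noteq> ?t" "?e \<noteq> ?d" using False by auto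
        have dA: "?d \<in> ?A" and eA: "?e \<in> ?A" using d(2,3) e(2,3) ne unfolding B by auto
        have 1: "matching_on (?B - {?t, ?d}) (N - {{?t, ?d}})" using matching_on_remove[OF N d(1)] .
        have "{?e, ?b} \<in> N - {{?t, ?d}}" using e(1) ne tb(3) by (auto simp: insert_commute doubleton_eq_iff)
        then have 2: "matching_on (?B - {?t, ?d} - {?e, ?b}) (N - {{?t, ?d}} - {{?e, ?b}})"
          using matching_on_remove[OF 1] by blast
        let ?M = "insert {?d, ?e} (N - {{?t, ?d}} - {{?e, ?b}})"
        have "matching_on (insert ?d (insert ?e (?B - {?t, ?d} - {?e, ?b}))) ?M"
          by (rule matching_on_insert[OF 2]) (use ne in auto)
        moreover have "insert ?d (insert ?e (?B - {?t, ?d} - {?e, ?b})) = ?A"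
          unfolding B using dA eA tb by blast
        ultimately have M: "matching_on ?A ?M" by simp
        have mt: "mate ?M ?d = ?e" by (rule mate_eq[OF M]) simp
        have no: "{?d, ?e} \<notin> N"
        proof
          assume "{?d, ?e} \<in> N"
          then have "{?d, ?e} = {?t, ?d}"
            using matching_on_same_edge[OF N _ d(1), of "{?d, ?e}" ?d] by simp
          then show False using ne by blast
        qed
        have "enlarge (Suc m) ?d ?M = insert {?t, ?d} (insert {?e, ?b} (N - {{?t, ?d}} - {{?e, ?b}}))"
          unfolding enlarge_def using False mt old(2)[OF M dA] no by auto
        also have "\<dots> = N" using d(1) e(1) by (auto simp: insert_commute)
        finally show ?thesis using M dA False by (simp add: Let_def perfect_matchings_iff)
      qed
    qed
    show "\<forall>N\<in>perfect_matchings (Suc m). (case ?shrink N of (M, d) \<Rightarrow> enlarge (Suc m) d M) = N"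
      by (rule ballI) (rule conjunct2[OF expand])
    show "?shrink ` perfect_matchings (Suc m) \<subseteq> perfect_matchings m \<times> usable_dots m"
      by (rule image_subsetI) (rule conjunct1[OF expand])
  qed
qed

section \<open>Chains of partners and the map H\<close>

definition is_partner :: "otree \<Rightarrow> nat \<Rightarrow> bool" where
  "is_partner T u \<longleftrightarrow> (\<exists>i. KV T i \<and> partner T i = u)"

text \<open>
  Chains in this relation ascend from a KV to its partner; \<open>map_H\<close> follows them downwards.
\<close>

definition partner_step :: "otree \<Rightarrow> (nat \<times> nat) set" where
  "partner_step T = {(i, partner T i) | i. KV T i}"

text \<open>
  Termination: a KV is smaller than its partner.
\<close>

lemma map_H_spec:
  assumes T: "T \<in> inc_trees n"
  shows "(map_H T v, v) \<in> (partner_step T)\<^sup>*" "\<not> is_partner T (map_H T v)"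
proof -
  let ?b = "\<lambda>u. \<exists>i. KV T i \<and> partner T i = u" and ?c = "\<lambda>u. THE i. KV T i \<and> partner T i = u"
  have c: "KV T (?c u) \<and> partner T (?c u) = u" if "?b u" for u
    by (rule theI') (use that partner_inj[OF T] in blast)
  have "(while ?b ?c v, v) \<in> (partner_step T)\<^sup>* \<and> \<not> is_partner T (while ?b ?c v)"
  proof (rule while_rule[where P = "\<lambda>u. (u, v) \<in> (partner_step T)\<^sup>*" and r = less_than])
    fix u assume u: "(u, v) \<in> (partner_step T)\<^sup>*" "?b u"
    have "(?c u, u) \<in> partner_step T" using c[OF u(2)] by (force simp: partner_step_def)
    then show "(?c u, v) \<in> (partner_step T)\<^sup>*" using u(1) by (rule converse_rtrancl_into_rtrancl)
    show "(?c u, u) \<in> less_than" using c[OF u(2)] partner_cases(1)[OF T, of "?c u"] by simp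
  qed (auto simp: is_partner_def)
  then show "(map_H T v, v) \<in> (partner_step T)\<^sup>*" "\<not> is_partner T (map_H T v)"
    by (simp_all add: map_H_def)
qed

lemma map_H_range:
  assumes T: "T \<in> inc_trees n" and "1 \<le> v" "v \<le> n"
  shows "1 \<le> map_H T v" "map_H T v \<le> n"
proof -
  have "map_H T v = v \<or> KV T (map_H T v)"
    using map_H_spec(1)[OF T, of v] by (auto simp: partner_step_def elim: converse_rtranclE)
  then show "1 \<le> map_H T v" "map_H T v \<le> n" using assms KV_range[OF T] by metis+
qed

text \<open>
  Ascend from \<open>k\<close> along partners until a Klazar compliant vertex \<open>v\<close> is reached. Both
  \<open>k\<close> and \<open>map_H T v\<close> are obtained by descending from \<open>v\<close> to a
  non-partner, and by \<open>partner_inj\<close> the descent is deterministic, so they agree.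
\<close>

lemma map_H_surj:
  assumes T: "T \<in> inc_trees n" and k: "1 \<le> k" "k \<le> n" "\<not> is_partner T k"
  obtains v where "1 \<le> v" "v \<le> n" "\<not> KV T v" "map_H T v = k"
proof -
  have "\<exists>v. (k, v) \<in> (partner_step T)\<^sup>* \<and> \<not> KV T v \<and> 1 \<le> v \<and> v \<le> n"
    using k(1,2)
  proof (induction "n - k" arbitrary: k rule: less_induct)
    case less
    show ?case
    proof (cases "KV T k")
      case True
      have p: "k < partner T k" "partner T k \<le> n" using partner_cases[OF T True] by auto
      then obtain v where v: "(partner T k, v) \<in> (partner_step T)\<^sup>*" "\<not> KV T v" "1 \<le> v" "v \<le> n"
        using less.hyps[of "partner T k"] less.prems diff_less_mono2[of k "partner T k" n] by force
      have "(k, partner T k) \<in> partner_step T" using True by (auto simp: partner_step_def)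
      then show ?thesis using v converse_rtrancl_into_rtrancl by metis
    qed (use less.prems in blast)
  qed
  then obtain v where v: "(k, v) \<in> (partner_step T)\<^sup>*" "\<not> KV T v" "1 \<le> v" "v \<le> n" by blast
  \<comment> \<open>No two KVs share a partner.\<close>
  have sv: "single_valued ((partner_step T)\<inverse>)"
    using partner_inj[OF T] by (auto simp: single_valued_def partner_step_def)
  have end_point: "y = z" if "(y, z) \<in> ((partner_step T)\<inverse>)\<^sup>*" "\<not> is_partner T y" for y z
    using that unfolding is_partner_def partner_step_def by (cases rule: converse_rtranclE) auto
  let ?w = "map_H T v"
  have "(v, k) \<in> ((partner_step T)\<inverse>)\<^sup>*" "(v, ?w) \<in> ((partner_step T)\<inverse>)\<^sup>*"
    using v(1) map_H_spec(1)[OF T, of v] by (simp_all add: rtrancl_converse)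
  from single_valued_confluent[OF sv this]
  have "?w = k" using end_point k(3) map_H_spec(2)[OF T, of v] by metis
  then show ?thesis using that v by blast
qed

section \<open>Reducing a tree to a smaller tree and a dot\<close>

text \<open>
  The tree of size \<open>n - 1\<close> to which \<open>Phi\<close> is applied recursively, and the used dot, when
  \<open>n\<close> is grafted onto \<open>T\<close> at the site \<open>p\<close>. All conditions refer to
  \<open>T\<close> itself and not to the grafted tree.
\<close>

definition tree_and_dot :: "nat \<Rightarrow> otree \<Rightarrow> nat + nat \<Rightarrow> otree \<times> nat" where
  "tree_and_dot n T p = (case p of
     Inl u \<Rightarrow> (T, if u = 0 then bot_dot n
                else if KV T u then bot_dot u else top_dot (map_H T u))
   | Inr j \<Rightarrow> if KV T j then (toggle j T, bot_dot j)
              else if T j = [] then (T, bot_dot j)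
              else (toggle j T, top_dot (partner (toggle j T) j)))"

lemma old_dots: "1 \<le> j \<Longrightarrow> j \<le> m \<Longrightarrow> bot_dot j \<in> {1..2 * m} \<and> top_dot j \<in> {1..2 * m}"
  by (auto simp: bot_dot_def top_dot_def)

lemma tree_and_dot_range:
  assumes T: "T \<in> inc_trees m" and p: "p \<in> graft_sites m"
  shows "tree_and_dot n T p \<in> inc_trees m \<times> insert (bot_dot n) {1..2 * m}"
proof (cases p)
  case (Inl u)
  then have "u \<le> m" using p by auto
  then show ?thesis
    using Inl T old_dots[of u m] old_dots[of "map_H T u" m] map_H_range[OF T, of u]
    by (auto simp: tree_and_dot_def)
next
  case (Inr j)
  then have j: "1 \<le> j" "j \<le> m" using p by auto
  have "toggle j T \<in> inc_trees m \<and> top_dot (partner (toggle j T) j) \<in> {1..2 * m}"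
    if "\<not> KV T j" "T j \<noteq> []"
  proof -
    note t = toggle_not_KV[OF T j that]
    have "1 \<le> partner (toggle j T) j" "partner (toggle j T) j \<le> m"
      using partner_cases(1,2)[OF t(1,2)] by auto
    then show ?thesis using t(1) old_dots by blast
  qed
  then show ?thesis
    using Inr T old_dots[OF j] toggle_KV(1)[OF T] by (auto simp: tree_and_dot_def)
qed

text \<open>
  The dot \<open>j\<close> bot comes from one of three sites, according to whether \<open>j\<close> is a KV, a
  Klazar compliant leaf, or a Klazar compliant non-leaf of \<open>S\<close>. The dot \<open>k\<close> top comes
  from the KV of which \<open>k\<close> is the partner, or else from \<open>map_H\<close>.
\<close>

lemma tree_and_dot_surj:
  assumes S: "S \<in> inc_trees m" and d: "d \<in> usable_dots m"
  shows "\<exists>T\<in>inc_trees m. \<exists>p\<in>graft_sites m. tree_and_dot (Suc m) T p = (S, d)"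
proof -
  consider "d = bot_dot (Suc m)" | j where "1 \<le> j" "j \<le> m" "d = bot_dot j"
    | k where "1 \<le> k" "k \<le> m" "d = top_dot k"
  proof (cases "d = bot_dot (Suc m)")
    case False
    then have d: "1 \<le> d" "d \<le> 2 * m" using d by auto
    show ?thesis
    proof (cases "even d")
      case True
      then show ?thesis using d that(2)[of "d div 2"] by (auto simp: bot_dot_def)
    next
      case False
      then show ?thesis using d that(3)[of "(d + 1) div 2"] by (auto simp: top_dot_def elim!: oddE)
    qed
  qed (use that in blast)
  then show ?thesis
  proof cases
    case 1
    then have "tree_and_dot (Suc m) S (Inl 0) = (S, d)" by (simp add: tree_and_dot_def)
    then show ?thesis using S by force
  next
    case (2 j)
    note j = this
    consider "KV S j" | "\<not> KV S j" "S j = []" | "\<not> KV S j" "S j \<noteq> []" by blast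
    then show ?thesis
    proof cases
      case 1
      then have "tree_and_dot (Suc m) S (Inl j) = (S, d)" using j 1 by (simp add: tree_and_dot_def)
      then show ?thesis using S j by force
    next
      case 2
      then have "tree_and_dot (Suc m) S (Inr j) = (S, d)" using j 2 by (simp add: tree_and_dot_def)
      then show ?thesis using S j by force
    next
      case 3
      note t = toggle_not_KV[OF S j(1,2) 3]
      have "tree_and_dot (Suc m) (toggle j S) (Inr j) = (S, d)" using j t by (simp add: tree_and_dot_def)
      then show ?thesis using t(1) j by force
    qed
  next
    case (3 k)
    show ?thesis
    proof (cases "is_partner S k")
      case True
      then obtain i where i: "KV S i" "partner S i = k" by (auto simp: is_partner_def)
      note t = toggle_KV[OF S i(1)] and r = KV_range[OF S i(1)]
      have "tree_and_dot (Suc m) (toggle i S) (Inr i) = (S, d)" using 3 i t by (simp add: tree_and_dot_def)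
      then show ?thesis using t(1) r by force
    next
      case False
      then obtain v where v: "1 \<le> v" "v \<le> m" "\<not> KV S v" "map_H S v = k"
        using map_H_surj[OF S 3(1,2)] by blast
      then have "tree_and_dot (Suc m) S (Inl v) = (S, d)" using 3 by (simp add: tree_and_dot_def)
      then show ?thesis using S v by force
    qed
  qed
qed

text \<open>
  There are \<open>(m + 1) + m\<close> sites and \<open>2m + 1\<close> dots, so surjectivity suffices.
\<close>

lemma tree_and_dot_bij:
  assumes "finite (inc_trees m)"
  shows "bij_betw (\<lambda>(T, p). tree_and_dot (Suc m) T p)
    (inc_trees m \<times> graft_sites m) (inc_trees m \<times> usable_dots m)"
proof -
  let ?f = "\<lambda>(T, p). tree_and_dot (Suc m) T p"
  have "?f ` (inc_trees m \<times> graft_sites m) = inc_trees m \<times> usable_dots m"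
  proof (intro equalityI subsetI)
    fix y assume "y \<in> ?f ` (inc_trees m \<times> graft_sites m)"
    then show "y \<in> inc_trees m \<times> usable_dots m"
      using tree_and_dot_range[of _ m _ "Suc m"] by (auto split: prod.splits)
  next
    fix y assume "y \<in> inc_trees m \<times> usable_dots m"
    then obtain S d where y: "y = (S, d)" "S \<in> inc_trees m" "d \<in> usable_dots m" by blast
    obtain T p where "T \<in> inc_trees m" "p \<in> graft_sites m" "tree_and_dot (Suc m) T p = y"
      using tree_and_dot_surj[OF y(2,3)] y(1) by blast
    then show "y \<in> ?f ` (inc_trees m \<times> graft_sites m)" by (intro image_eqI[of _ _ "(T, p)"]) simp_all
  qed
  moreover have "card (inc_trees m \<times> graft_sites m) = card (inc_trees m \<times> usable_dots m)"
    by (simp add: card_cartesian_product card_Plus bot_dot_def)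
  moreover have "finite (inc_trees m \<times> graft_sites m)" using assms by simp
  ultimately show ?thesis
    unfolding bij_betw_def by (metis eq_card_imp_inj_on)
qed

section \<open>Klazar violators after inserting the largest vertex\<close>

text \<open>
  A child larger than all other vertices does not affect the comparison of the associate with the
  children, but it becomes the partner.
\<close>

lemma graft_Inl_KV:
  assumes T: "T \<in> inc_trees m" and u: "1 \<le> u" "u \<le> m"
  shows "KV (graft (Suc m) T (Inl u)) u \<longleftrightarrow> KV T u"
    "KV T u \<Longrightarrow> partner (graft (Suc m) T (Inl u)) u = Suc m"
proof -
  let ?G = "graft (Suc m) T (Inl u)"
  have G: "?G \<in> inc_trees (Suc m)" by (rule graft_inc_trees[OF T]) (use u in auto)
  obtain w ps qs where s: "T w = ps @ u # qs" using inc_trees_child_split[OF T u] .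
  have "w \<noteq> u" using inc_trees_child(1)[OF T, of u w] s by auto
  then have sG: "?G w = ps @ u # qs" using s by (simp add: graft_def)
  have ps: "x \<le> m" if "x \<in> set ps" for x using inc_trees_child(2)[OF T, of x w] s that by auto
  \<comment> \<open>An associate is an old vertex, hence smaller than the new child.\<close>
  have r: "Min (set (larger_suffix u ps)) < Suc m" if "larger_suffix u ps \<noteq> []"
  proof -
    have "Min (set (larger_suffix u ps)) \<in> set (larger_suffix u ps)" using that by simp
    moreover have "set (larger_suffix u ps) \<subseteq> set ps"
      by (rule larger_suffix_split[of ps u]) (metis Un_upper2 set_append)
    ultimately show ?thesis using ps by (metis le_imp_less_Suc subsetD)
  qed
  show "KV ?G u \<longleftrightarrow> KV T u"
    unfolding KV_iff[OF T s] KV_iff[OF G sG] using r by (auto simp: graft_def)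
  show "partner ?G u = Suc m" if k: "KV T u"
  proof -
    have "ps \<noteq> []" using k KV_iff[OF T s] by auto
    then have "last ps \<le> m" using ps by simp
    then show ?thesis unfolding partner_eq[OF G sG] by (simp add: graft_def)
  qed
qed

text \<open>
  To the right of \<open>n\<close> there is a sibling \<open>j < n\<close>, or no vertex at all. In the first
  case \<open>j\<close> hides \<open>n\<close> from all vertices further to the right.
\<close>

lemma graft_other_KV:
  assumes T: "T \<in> inc_trees m" and p: "p \<in> graft_sites m" and i: "1 \<le> i" "i \<le> m"
    and ne: "p \<noteq> Inl i" "p \<noteq> Inr i"
  shows "(KV (graft (Suc m) T p) i \<longleftrightarrow> KV T i) \<and>
    (KV T i \<longrightarrow> partner (graft (Suc m) T p) i = partner T i)"
proof -
  let ?n = "Suc m" let ?G = "graft ?n T p"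
  have G: "?G \<in> inc_trees ?n" by (rule graft_inc_trees[OF T p])
  obtain w ps qs where s: "T w = ps @ i # qs" using inc_trees_child_split[OF T i] .
  have goal: ?thesis if "?G w = ps' @ i # qs'" "same_Min_last (larger_suffix i ps') (larger_suffix i ps)"
    "same_Min_last (?G i) (T i)" for ps' qs'
    using KV_partner_cong[OF G T that(1) s that(2,3)] by auto
  show ?thesis
  proof (cases p)
    case (Inl u)
    then have "u \<noteq> i" using ne by blast
    then show ?thesis
      by (intro goal[of ps "qs @ (if u = w then [?n] else [])"]) (use s in \<open>auto simp: Inl graft_def\<close>)
  next
    case (Inr j)
    then have j: "1 \<le> j" "j \<le> m" "i \<noteq> j" using p ne by auto
    obtain x Y Z where sj: "T x = Y @ j # Z" using inc_trees_child_split[OF T j(1,2)] .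
    have gr: "?G = T(x := Y @ ?n # j # Z)" unfolding Inr by (rule graft_Inr[OF T sj])
    have ag: "same_Min_last (?G i) (T i)"
    proof (cases "i = x")
      case True
      \<comment> \<open>The child \<open>j\<close> remains to the right of the new child \<open>n\<close> and is smaller.\<close>
      have "same_Min_last (Y @ [?n] @ [] @ j # Z) (Y @ [] @ j # Z)" by (rule same_Min_last_delete) (use j in auto)
      then show ?thesis by (simp add: True gr sj)
    qed (simp add: gr)
    show ?thesis
    proof (cases "w = x")
      case False
      then show ?thesis by (intro goal[of ps qs]) (simp_all add: ag, simp add: gr s)
    next
      case True
      then have eq: "ps @ i # qs = Y @ j # Z" using s sj by simp
      then have "i \<in> set Y \<or> i \<in> set Z" using j(3) by (metis in_set_conv_decomp Un_iff set_append set_ConsD)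
      then show ?thesis
      proof
        assume "i \<in> set Y"
        then obtain Y1 Y2 where Y: "Y = Y1 @ i # Y2" by (meson split_list)
        then have "T w = Y1 @ i # (Y2 @ j # Z)" using True sj by simp
        then have "ps = Y1" using sibling_split_unique(2)[OF T s] by blast
        then show ?thesis
          by (intro goal[of ps "Y2 @ ?n # j # Z"]) (simp_all add: ag, simp add: gr True Y)
      next
        assume "i \<in> set Z"
        then obtain Z1 Z2 where Z: "Z = Z1 @ i # Z2" by (meson split_list)
        then have "T w = (Y @ j # Z1) @ i # Z2" using True sj by simp
        then have ps: "ps = Y @ j # Z1" using sibling_split_unique(2)[OF T s] by blast
        have "same_Min_last (larger_suffix i (Y @ [?n] @ [] @ j # Z1)) (larger_suffix i (Y @ [] @ j # Z1))"
          by (rule same_Min_last_larger_suffix) (use j in auto)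
        then show ?thesis
          by (intro goal[of "Y @ ?n # j # Z1" Z2]) (simp_all add: ag ps, simp add: gr True Z)
      qed
    qed
  qed
qed

lemma graft_Inr_partner:
  assumes T: "T \<in> inc_trees m" and j: "1 \<le> j" "j \<le> m"
  shows "partner (graft (Suc m) T (Inr j)) j = Suc m"
proof -
  let ?G = "graft (Suc m) T (Inr j)"
  have G: "?G \<in> inc_trees (Suc m)" by (rule graft_inc_trees[OF T]) (use j in auto)
  obtain w ps qs where s: "T w = ps @ j # qs" using inc_trees_child_split[OF T j] .
  have sG: "?G w = (ps @ [Suc m]) @ j # qs" by (simp add: graft_Inr[OF T s])
  have "last (?G j) \<le> Suc m" if "?G j \<noteq> []"
    using inc_trees_child(2)[OF G, of "last (?G j)" j] that by simp
  then show ?thesis unfolding partner_eq[OF G sG] by auto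
qed

text \<open>
  Grafting turns a transfer around \<open>j\<close> into a transfer around \<open>j\<close> with the same
  \<open>a\<close>, and \<open>a\<close> is a vertex of \<open>T\<close>.
\<close>

lemma graft_Inr_KV:
  assumes T: "T \<in> inc_trees m" and "KV T j"
  shows "KV (graft (Suc m) T (Inr j)) j" "associate (graft (Suc m) T (Inr j)) j \<noteq> Suc m"
    "toggle j (graft (Suc m) T (Inr j)) = graft (Suc m) (toggle j T) (Inr j)"
proof -
  obtain T' w X B1 a B2 Z where "tree_transfer T T' w j X B1 a B2 Z m"
    using KV_transfer[OF assms] .
  then interpret tree_transfer T T' w j X B1 a B2 Z m .
  have "a \<le> m" using inc_trees_child(2)[OF T, of a w] before by simp
  then have a: "a < Suc m" by simp
  have "graft (Suc m) T (Inr j) \<in> inc_trees (Suc m)"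
    by (rule graft_inc_trees[OF T]) (use KV_range[OF assms] in auto)
  then interpret g: tree_transfer "graft (Suc m) T (Inr j)" "graft (Suc m) T' (Inr j)"
    w j X B1 a "B2 @ [Suc m]" Z "Suc m"
    by (intro tree_transfer.intro graft_transfer[OF a] tree_transfer_axioms.intro)
  show "KV (graft (Suc m) T (Inr j)) j" by (rule g.KV_before)
  show "associate (graft (Suc m) T (Inr j)) j \<noteq> Suc m" unfolding g.associate_before using a by simp
  show "toggle j (graft (Suc m) T (Inr j)) = graft (Suc m) (toggle j T) (Inr j)"
    unfolding g.toggle_before toggle_before ..
qed

lemma graft_Inr_not_KV:
  assumes T: "T \<in> inc_trees m" and j: "1 \<le> j" "j \<le> m" and k: "\<not> KV T j" "T j \<noteq> []"
  shows "\<not> KV (graft (Suc m) T (Inr j)) j"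
    "toggle j (graft (Suc m) T (Inr j)) = graft (Suc m) (toggle j T) (Inr j)"
proof -
  obtain T0 w X B1 a B2 Z where "tree_transfer T0 T w j X B1 a B2 Z m"
    using not_KV_transfer[OF assms] .
  then interpret t: tree_transfer T0 T w j X B1 a B2 Z m .
  have "a \<le> m" using inc_trees_child(2)[OF t.T, of a w] t.before by simp
  then have a: "a < Suc m" by simp
  have "graft (Suc m) T0 (Inr j) \<in> inc_trees (Suc m)"
    by (rule graft_inc_trees[OF t.T]) (use j in auto)
  then interpret g: tree_transfer "graft (Suc m) T0 (Inr j)" "graft (Suc m) T (Inr j)"
    w j X B1 a "B2 @ [Suc m]" Z "Suc m"
    by (intro tree_transfer.intro t.graft_transfer[OF a] tree_transfer_axioms.intro)
  show "\<not> KV (graft (Suc m) T (Inr j)) j" by (rule g.not_KV_after)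
  show "toggle j (graft (Suc m) T (Inr j)) = graft (Suc m) (toggle j T) (Inr j)"
    unfolding g.toggle_after t.toggle_after ..
qed

text \<open>
  The big cohort of a Klazar compliant leaf is empty, so after the grafting it consists of
  \<open>n\<close> only.
\<close>

lemma graft_Inr_leaf:
  assumes T: "T \<in> inc_trees m" and j: "1 \<le> j" "j \<le> m" and k: "\<not> KV T j" "T j = []"
  shows "KV (graft (Suc m) T (Inr j)) j" "associate (graft (Suc m) T (Inr j)) j = Suc m"
proof -
  let ?G = "graft (Suc m) T (Inr j)"
  have G: "?G \<in> inc_trees (Suc m)" by (rule graft_inc_trees[OF T]) (use j in auto)
  obtain w ps qs where s: "T w = ps @ j # qs" using inc_trees_child_split[OF T j] .
  have sG: "?G w = (ps @ [Suc m]) @ j # qs" by (simp add: graft_Inr[OF T s])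
  have "w \<noteq> j" using inc_trees_child(1)[OF T, of j w] s by auto
  then have c: "?G j = []" using k(2) by (simp add: graft_Inr[OF T s])
  have "larger_suffix j ps = []" using k KV_iff[OF T s] by simp
  then have r: "larger_suffix j (ps @ [Suc m]) = [Suc m]"
    using j by (simp add: larger_suffix_append)
  show "KV ?G j" unfolding KV_iff[OF G sG] r by (simp add: c)
  show "associate ?G j = Suc m" unfolding associate_def big_cohort_eq[OF G sG] r by simp
qed

section \<open>The recursion for Phi\<close>

text \<open>
  The six cases of the definition of \<open>Phi\<close>, expressed by the tree without its largest vertex.
  The recursion of \<open>Phi\<close> starts at size 1, but it is consistent with the value at size 0: from the
  empty diagram, the only site \<open>Inl 0\<close> produces the diagram of size 1.
\<close>

lemma Phi_graft:
  assumes T: "T \<in> inc_trees m" and p: "p \<in> graft_sites m"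
  shows "Phi (Suc m) (graft (Suc m) T p) =
    (case tree_and_dot (Suc m) T p of (S, d) \<Rightarrow> enlarge (Suc m) d (Phi m S))"
proof (cases m)
  case 0
  then have "p = Inl 0" using p by auto
  then show ?thesis by (simp add: 0 tree_and_dot_def enlarge_def enlarge_new_def)
next
  case m: (Suc k)
  let ?n = "Suc m" let ?G = "graft ?n T p"
  have G: "?G \<in> inc_trees ?n" by (rule graft_inc_trees[OF T p])
  have D: "delete_max ?n ?G = T" by (rule delete_max_graft[OF T p])
  have old: "bot_dot j \<noteq> bot_dot ?n" "1 \<le> i \<Longrightarrow> top_dot i \<noteq> bot_dot ?n" if "j \<le> m" for i j
    using that by (simp add: bot_dot_def, simp add: bot_dot_def top_dot_def, presburger)
  note Phi_n = Phi.simps(3)[of k, folded m, unfolded Let_def]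
  show ?thesis
  proof (cases p)
    case (Inl u)
    then have u: "u \<le> m" using p by auto
    have Gu: "?G u = T u @ ?n # []" by (simp add: Inl graft_def)
    have "\<not> left_neighbor ?G ?n j" for j
      using sibling_split_unique(3)[OF G Gu] unfolding left_neighbor_def by (metis list.discI)
    then have l: "(\<exists>j. left_neighbor ?G ?n j) = False" by blast
    have P: "parent ?G ?n = u" by (rule parent_eq[OF G]) (simp add: Gu)
    have "KV ?G u \<longleftrightarrow> KV T u" if "u \<noteq> 0"
      using graft_Inl_KV(1)[OF T _ u] that Inl by simp
    moreover have "1 \<le> map_H T u" if "u \<noteq> 0" using map_H_range(1)[OF T _ u] that by simp
    ultimately show ?thesis
      using old[OF u] unfolding Phi_n D P l if_False
      by (simp add: Inl tree_and_dot_def enlarge_def)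
  next
    case (Inr j)
    then have j: "1 \<le> j" "j \<le> m" using p by auto
    obtain w ps qs where s: "T w = ps @ j # qs" using inc_trees_child_split[OF T j] .
    have sG: "?G w = ps @ ?n # j # qs" unfolding Inr graft_Inr[OF T s] by simp
    have l: "left_neighbor ?G ?n x \<longleftrightarrow> x = j" for x
      using sG sibling_split_unique(3)[OF G sG] unfolding left_neighbor_def by blast
    have PF: "delete_max ?n (map_F ?n ?G) = toggle j T"
      if "toggle j ?G = graft ?n (toggle j T) (Inr j)" "KV ?G j \<Longrightarrow> associate ?G j \<noteq> ?n"
        "toggle j T \<in> inc_trees m"
    proof -
      have "map_F ?n ?G = toggle j ?G" using that(2) by (rule map_F_toggle[OF G sG])
      also note that(1)
      finally show ?thesis using delete_max_graft[OF that(3) p] Inr by simp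
    qed
    have Phi_G: "Phi ?n ?G =
       (if KV ?G j \<and> associate ?G j = ?n then enlarge_old ?n (bot_dot j) (Phi m T)
        else if KV ?G j then enlarge_old ?n (bot_dot j) (Phi m (delete_max ?n (map_F ?n ?G)))
        else enlarge_old ?n (top_dot (partner (delete_max ?n (map_F ?n ?G)) j))
          (Phi m (delete_max ?n (map_F ?n ?G))))"
      unfolding Phi_n D l by simp
    consider "KV T j" | "\<not> KV T j" "T j = []" | "\<not> KV T j" "T j \<noteq> []" by blast
    then show ?thesis
    proof cases
      case 1
      note g = graft_Inr_KV[OF T 1, folded Inr]
      have "delete_max ?n (map_F ?n ?G) = toggle j T"
        using PF g toggle_KV(1)[OF T 1] unfolding Inr by blast
      then show ?thesis unfolding Phi_G using g 1 old(1)[OF j(2)]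
        by (simp add: Inr tree_and_dot_def enlarge_def)
    next
      case 2
      note g = graft_Inr_leaf[OF T j 2, folded Inr]
      show ?thesis unfolding Phi_G using g 2 old(1)[OF j(2)]
        by (simp add: Inr tree_and_dot_def enlarge_def)
    next
      case 3
      note g = graft_Inr_not_KV[OF T j 3, folded Inr] and t = toggle_not_KV[OF T j 3]
      have "delete_max ?n (map_F ?n ?G) = toggle j T"
        using PF g t(1) unfolding Inr by blast
      moreover have "1 \<le> partner (toggle j T) j" using partner_cases(1)[OF t(1,2)] by simp
      ultimately show ?thesis unfolding Phi_G using g 3 old(2)[OF j(2)]
        by (simp add: Inr tree_and_dot_def enlarge_def)
    qed
  qed
qed

section \<open>Uplines and bijectivity\<close>

lemma bot_neq_top: "1 \<le> q \<Longrightarrow> bot_dot i \<noteq> top_dot q"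
  by (simp add: bot_dot_def top_dot_def) presburger

lemma bot_dot_inj: "bot_dot i = bot_dot j \<longleftrightarrow> i = j"
  by (simp add: bot_dot_def)

lemma top_dot_inj: "1 \<le> i \<Longrightarrow> 1 \<le> j \<Longrightarrow> top_dot i = top_dot j \<longleftrightarrow> i = j"
  by (auto simp: top_dot_def)

text \<open>
  The dot \<open>d\<close> lies on none of the edges that are needed for the old KVs. If \<open>d\<close> is a
  bottom dot \<open>j\<close>, then \<open>j\<close> is either not a KV of \<open>S\<close> or receives the
  new partner. If \<open>d\<close> is a top dot, it belongs to a non-partner of \<open>S\<close>, or to the
  partner of a KV of \<open>S\<close> that is Klazar compliant in the grafted tree.
\<close>

lemma graft_KV_pairs:
  assumes T: "T \<in> inc_trees m" and p: "p \<in> graft_sites m"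
    and Sd: "tree_and_dot (Suc m) T p = (S, d)" and k: "KV (graft (Suc m) T p) i"
  defines "q \<equiv> partner (graft (Suc m) T p) i"
  shows "i \<le> m \<and> (d = bot_dot i \<and> q = Suc m \<or>
     KV S i \<and> partner S i = q \<and> d \<noteq> bot_dot i \<and> d \<noteq> top_dot q)"
proof -
  let ?n = "Suc m" let ?G = "graft ?n T p"
  have G: "?G \<in> inc_trees ?n" by (rule graft_inc_trees[OF T p])
  have iq: "i < q" "q \<le> ?n" using partner_cases(1,2)[OF G k] by (simp_all add: q_def)
  then have i: "1 \<le> i" "i \<le> m" using KV_range(1)[OF G k] by auto
  show ?thesis
  proof (cases p)
    case (Inl u)
    then have u: "u \<le> m" using p by auto
    have S: "S = T" and d: "d = (if u = 0 then bot_dot ?n else if KV T u then bot_dot u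
        else top_dot (map_H T u))"
      using Sd by (auto simp: Inl tree_and_dot_def)
    show ?thesis
    proof (cases "i = u")
      case True
      then have "KV T u" "q = ?n"
        using graft_Inl_KV[OF T _ u] i k Inl by (auto simp: q_def)
      then show ?thesis using True i d by auto
    next
      case False
      then have c: "KV T i" "partner T i = q"
        using graft_other_KV[OF T p i] k Inl by (auto simp: q_def)
      have "d \<noteq> bot_dot i"
        using False i map_H_range(1)[OF T _ u] bot_neq_top[of "map_H T u" i]
        by (auto simp: d bot_dot_inj)
      moreover have "d \<noteq> top_dot q"
      proof -
        have "map_H T u \<noteq> q" using map_H_spec(2)[OF T, of u] c by (auto simp: is_partner_def)
        then show ?thesis using iq map_H_range(1)[OF T _ u] bot_neq_top[of q]
          by (auto simp: d top_dot_inj)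
      qed
      ultimately show ?thesis using c i S by simp
    qed
  next
    case (Inr j)
    then have j: "1 \<le> j" "j \<le> m" using p by auto
    show ?thesis
    proof (cases "i = j")
      case True
      then have "KV T j \<or> T j = []"
        using graft_Inr_not_KV(1)[OF T j] k Inr by blast
      then have "d = bot_dot i" using Sd True by (auto simp: Inr tree_and_dot_def split: if_splits)
      then show ?thesis using True i graft_Inr_partner[OF T j] by (simp add: q_def Inr)
    next
      case False
      then have c: "KV T i" "partner T i = q"
        using graft_other_KV[OF T p i] k Inr by (auto simp: q_def)
      consider "S = toggle j T" "d = bot_dot j" "KV T j" | "S = T" "d = bot_dot j"
        | "S = toggle j T" "d = top_dot (partner S j)" "\<not> KV T j" "T j \<noteq> []"
        using Sd by (auto simp: Inr tree_and_dot_def split: if_splits)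
      then show ?thesis
      proof cases
        case 1
        then show ?thesis using toggle_other_KV[OF T j _ False] c i False iq
          by (auto simp: bot_dot_inj bot_neq_top)
      next
        case 2
        then show ?thesis using c i False iq by (auto simp: bot_dot_inj bot_neq_top)
      next
        case 3
        note t = toggle_not_KV[OF T j 3(3,4)]
        have cS: "KV S i" "partner S i = q" using toggle_other_KV[OF T j _ False] c 3 by auto
        have S: "S \<in> inc_trees m" "KV S j" using t 3 by auto
        have "partner S j \<noteq> q" using partner_inj[OF S(1) cS(1) S(2)] cS(2) False by auto
        moreover have "1 \<le> partner S j" using partner_cases(1)[OF S] by simp
        ultimately have "d \<noteq> top_dot q" "d \<noteq> bot_dot i"
          using iq 3(2) bot_neq_top[of "partner S j" i] by (auto simp: top_dot_inj)
        then show ?thesis using cS i by blast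
      qed
    qed
  qed
qed

lemma enlarge_keeps_edge: "e \<in> M \<Longrightarrow> d \<notin> e \<Longrightarrow> e \<in> enlarge n d M"
  by (auto simp: enlarge_def enlarge_new_def enlarge_old_def)

lemma enlarge_new_edge: "i < n \<Longrightarrow> {bot_dot i, top_dot n} \<in> enlarge n (bot_dot i) M"
  by (simp add: enlarge_def enlarge_old_def bot_dot_inj insert_commute)

lemma Phi_uplines:
  assumes "T \<in> inc_trees n" "KV T i"
  shows "upline (Phi n T) i (partner T i)"
  using assms
proof (induction n arbitrary: T i)
  case 0
  then show ?case using KV_range[OF 0] by simp
next
  case (Suc m)
  obtain T0 p where Tp: "T0 \<in> inc_trees m" "p \<in> graft_sites m" "T = graft (Suc m) T0 p"
    using graft_bij[of m] Suc.prems(1) unfolding bij_betw_def by force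
  obtain S d where Sd: "tree_and_dot (Suc m) T0 p = (S, d)" by fastforce
  have S: "S \<in> inc_trees m" using tree_and_dot_range[OF Tp(1,2), of "Suc m"] Sd by simp
  let ?q = "partner T i"
  have P: "Phi (Suc m) T = enlarge (Suc m) d (Phi m S)"
    unfolding Tp(3) Phi_graft[OF Tp(1,2)] Sd by simp
  have iq: "i < ?q" by (rule partner_cases(1)[OF Suc.prems])
  have "i \<le> m" and "d = bot_dot i \<and> ?q = Suc m \<or>
     KV S i \<and> partner S i = ?q \<and> d \<noteq> bot_dot i \<and> d \<noteq> top_dot ?q"
    using graft_KV_pairs[OF Tp(1,2) Sd] Suc.prems(2) unfolding Tp(3) by blast+
  then have "{bot_dot i, top_dot ?q} \<in> Phi (Suc m) T"
  proof (elim disjE)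
    assume "d = bot_dot i \<and> ?q = Suc m"
    then show ?thesis unfolding P using enlarge_new_edge[of i "Suc m"] \<open>i \<le> m\<close> by simp
  next
    assume c: "KV S i \<and> partner S i = ?q \<and> d \<noteq> bot_dot i \<and> d \<noteq> top_dot ?q"
    then have "{bot_dot i, top_dot ?q} \<in> Phi m S"
      using Suc.IH[OF S] unfolding upline_def by metis
    then show ?thesis unfolding P using c by (intro enlarge_keeps_edge) auto
  qed
  then show ?case using iq by (simp add: upline_def)
qed

text \<open>
  The induction starts at size 0, where the only tree and the only matching are empty. The finiteness
  of the set of trees, needed for counting, is inherited from the matchings through the induction
  hypothesis.
\<close>

lemma Phi_bij: "bij_betw (Phi n) (inc_trees n) (perfect_matchings n)"
proof (induction n)
  case 0
  have "inc_trees 0 = {\<lambda>_. []}"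
    by (auto simp: inc_trees_def fun_eq_iff)
  moreover have "perfect_matchings 0 = {{}}"
    by (auto simp: perfect_matchings_def partition_on_def)
  ultimately show ?case by simp
next
  case (Suc m)
  let ?sites = "inc_trees m \<times> graft_sites m"
  have "finite (perfect_matchings m)"
    by (rule finite_subset[of _ "Pow (Pow {1..2 * m})"])
      (auto simp: perfect_matchings_def partition_on_def)
  then have fin: "finite (inc_trees m)" using bij_betw_finite[OF Suc.IH] by simp
  have "bij_betw (map_prod (Phi m) id) (inc_trees m \<times> usable_dots m)
      (perfect_matchings m \<times> usable_dots m)"
    using Suc.IH by (auto intro: bij_betw_map_prod)
  note bij = bij_betw_trans[OF bij_betw_trans[OF tree_and_dot_bij[OF fin] this] enlarge_bij]
  have "((\<lambda>(M, d). enlarge (Suc m) d M) \<circ>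
        (map_prod (Phi m) id \<circ> (\<lambda>(T, p). tree_and_dot (Suc m) T p))) x =
      (Phi (Suc m) \<circ> (\<lambda>(T, p). graft (Suc m) T p)) x" if "x \<in> ?sites" for x
  proof -
    obtain T p where x: "x = (T, p)" "T \<in> inc_trees m" "p \<in> graft_sites m"
      using \<open>x \<in> ?sites\<close> by blast
    obtain S d where "tree_and_dot (Suc m) T p = (S, d)" by fastforce
    then show ?thesis using x by (simp add: Phi_graft)
  qed
  from bij_betw_cong[OF this, THEN iffD1, OF _ bij]
  have "bij_betw (Phi (Suc m) \<circ> (\<lambda>(T, p). graft (Suc m) T p)) ?sites (perfect_matchings (Suc m))" .
  then show ?case using bij_betw_comp_iff[OF graft_bij] by blast
qed

theorem theorem14:
  fixes n :: nat
  assumes "n \<ge> 1"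
  shows "bij_betw (Phi n) (inc_trees n) (perfect_matchings n) \<and>
         (\<forall>T\<in>inc_trees n. \<forall>i j. KV T i \<and> partner T i = j \<longrightarrow> upline (Phi n T) i j)"
  using Phi_bij Phi_uplines by blast

end
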